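(* Let $N\ge 1$, let $f:[N]\to\{0,1\}$ be a Boolean function, and suppose we are given a quantum $\varepsilon$-biased oracle $O^{\varepsilon}_f$ for $f$ together with the value of $\varepsilon$. Then there exists a quantum algorithm that computes $\mathrm{OR}(f(1),\dots,f(N))$ with probability at least $2/3$ using $O(\sqrt{N}/\varepsilon)$ queries to $O^{\varepsilon}_f$. Moreover, if the value $\varepsilon_{\min}$ is known, the algorithm uses $\Theta(\sqrt{N}/\varepsilon_{\min})$ queries.
   Context: A quantum oracle of a Boolean function $f:[N]\to\{0,1\}$ with bias $\varepsilon$ (an $\varepsilon$-biased oracle) is a unitary transformation $O^{\varepsilon}_f$ (queries may use $O^{\varepsilon}_f$ or its inverse ${O^{\varepsilon}_f}^\dagger$) such that for every $x\in[N]$, $O^{\varepsilon}_f\ket{x}\ket{0^{m-1}}\ket{0}=\ket{x}\big(\alpha_x\ket{w_x}\ket{f(x)}+\beta_x\ket{w'_x}\ket{\overline{f(x)}}\big)$, where $\ket{w_x},\ket{w'_x}$ are normalized states of the $(m-1)$-qubit work register and $|\alpha_x|^2=1/2+\varepsilon_x\ge 1/2+\varepsilon$. Here $\varepsilon_{\min}=\min_x\varepsilon_x$, so $0<\varepsilon\le\varepsilon_{\min}\le\varepsilon_x\le 1/2$. The query complexity is the number of applications of the oracle (or its inverse) in a quantum algorithm $U_0\to O_1\to U_1\to\cdots\to O_T\to U_T$, where the $U_i$ are arbitrary oracle-independent unitaries. *)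

theory Defs
  imports "HOL-Analysis.Analysis"
begin

(* Basis states of the full register: (x, r, a) with
   x < N   : query register (the input x in [N], 0-indexed),
   r < 2^m : oracle register |w>|b>, encoded r = 2*w + b (b = answer qubit, last),
   a < 2^q : algorithm's own ancilla (q qubits). *)
type_synonym idx = "nat \<times> nat \<times> nat"

definition basis :: "nat \<Rightarrow> nat \<Rightarrow> nat \<Rightarrow> idx set" where
  "basis N m q = {0..<N} \<times> {0..<2^m} \<times> {0..<2^q}"

definition apply_op :: "'a set \<Rightarrow> ('a \<Rightarrow> 'a \<Rightarrow> complex) \<Rightarrow> ('a \<Rightarrow> complex) \<Rightarrow> ('a \<Rightarrow> complex)" where
  "apply_op S U \<psi> = (\<lambda>i. if i \<in> S then (\<Sum>j\<in>S. U i j * \<psi> j) else 0)"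

definition is_unitary_on :: "'a set \<Rightarrow> ('a \<Rightarrow> 'a \<Rightarrow> complex) \<Rightarrow> bool" where
  "is_unitary_on S U \<longleftrightarrow>
     (\<forall>i\<in>S. \<forall>j\<in>S. (\<Sum>k\<in>S. cnj (U k i) * U k j) = (if i = j then 1 else 0))"

definition adj :: "('a \<Rightarrow> 'a \<Rightarrow> complex) \<Rightarrow> ('a \<Rightarrow> 'a \<Rightarrow> complex)" where
  "adj U = (\<lambda>i j. cnj (U j i))"

definition normalized_work :: "nat \<Rightarrow> (nat \<Rightarrow> complex) \<Rightarrow> bool" where
  "normalized_work m v \<longleftrightarrow> (\<Sum>w<2^(m-1). (cmod (v w))^2) = 1"

(* Orc is an eps-biased oracle for f : [N] -> {0,1} acting on x-register and m-qubit register.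
   Orc |x>|0^{m-1}>|0> = |x>(alpha_x |w_x>|f x> + beta_x |w'_x>|not f x>), |alpha_x|^2 >= 1/2 + eps *)
definition biased_oracle ::
  "nat \<Rightarrow> nat \<Rightarrow> (nat \<Rightarrow> bool) \<Rightarrow> real \<Rightarrow> (nat \<times> nat \<Rightarrow> nat \<times> nat \<Rightarrow> complex) \<Rightarrow> bool" where
  "biased_oracle N m f \<epsilon> Orc \<longleftrightarrow>
     m \<ge> 1 \<and>
     is_unitary_on ({0..<N} \<times> {0..<2^m}) Orc \<and>
     (\<forall>x<N.
        (\<forall>x' r. x' < N \<and> r < 2^m \<and> x' \<noteq> x \<longrightarrow> Orc (x', r) (x, 0) = 0) \<and>
        (\<exists>\<alpha> \<beta> wx wx'. normalized_work m wx \<and> normalized_work m wx' \<and>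
           (cmod \<alpha>)^2 \<ge> 1/2 + \<epsilon> \<and>
           (\<forall>w<2^(m-1). \<forall>b<2.
              Orc (x, 2*w + b) (x, 0) =
                \<alpha> * wx w * (if (b = 1) = f x then 1 else 0)
              + \<beta> * wx' w * (if (b = 1) = f x then 0 else 1))))"

definition lift_oracle :: "(nat \<times> nat \<Rightarrow> nat \<times> nat \<Rightarrow> complex) \<Rightarrow> (idx \<Rightarrow> idx \<Rightarrow> complex)" where
  "lift_oracle Orc = (\<lambda>(x, r, a) (x', r', a'). Orc (x, r) (x', r') * (if a = a' then 1 else 0))"

fun run :: "idx set \<Rightarrow> (nat \<Rightarrow> idx \<Rightarrow> idx \<Rightarrow> complex) \<Rightarrow> (nat \<Rightarrow> bool)
            \<Rightarrow> (idx \<Rightarrow> idx \<Rightarrow> complex) \<Rightarrow> nat \<Rightarrow> (idx \<Rightarrow> complex)" where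
  "run S Us useinv Q 0 = apply_op S (Us 0) (\<lambda>i. if i = (0, 0, 0) then 1 else 0)"
| "run S Us useinv Q (Suc k) =
     apply_op S (Us (Suc k)) (apply_op S (if useinv k then adj Q else Q) (run S Us useinv Q k))"

definition prob_output :: "idx set \<Rightarrow> (idx \<Rightarrow> complex) \<Rightarrow> (idx \<Rightarrow> bool) \<Rightarrow> bool \<Rightarrow> real" where
  "prob_output S \<psi> out v = (\<Sum>i\<in>{i\<in>S. out i = v}. (cmod (\<psi> i))^2)"

end

(* Write V = O^dagger B O, where B moves a token along a half-line of positions: if the answer
   qubit is 1 it exchanges 2j with 2j+1, if it is 0 it exchanges 2j+1 with 2j+2. Let G be the sign
   (-1)^k at position k, times -1 if the oracle register is not |0>. Because the bias has a definite
   sign, the recurrence relating neighbouring positions has a geometrically decaying solution with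
   ratio t = P(wrong answer) / P(right answer) <= 1 - 2 eps: if f(x) = 0 there is a vector |x> + v
   with G v = v and V(|x> + v) = |x> + v, if f(x) = 1 one with G v = -v and
   V(|x> + v) = -(|x> + v), and in both cases the squared norm is O(1/eps). So V and G together act
   as a perfect phase oracle on |x>, at the price of the catalyst v and with no dependence on the
   individual biases. (The line is cut off at an exponentially small amplitude; this costs ancilla
   qubits but no queries.)

   Add a start state * and let D reflect the span of * and the |x> about
   chi = sqrt(1 - eps/4) * + sqrt(eps/4) |uniform>, and act as G elsewhere. Let W = D V.
   If f = 0 then chi plus its catalysts is fixed by W and has constant overlap with *.
   If f(x) = 1 for some x then * = W phi - phi up to the cut-off error, where
   |phi| = O(sqrt N / eps). Hence the average of W^j * over j < K, with K of order sqrt N / eps, is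
   long in the first case and short, by telescoping, in the second; an ancilla counter j in uniform
   superposition turns the squared norm of the average into an output probability. *)
theory Submission
  imports Defs
begin

section \<open>Linear isometries and averages of orbits\<close>

definition ip :: "'a set \<Rightarrow> ('a \<Rightarrow> complex) \<Rightarrow> ('a \<Rightarrow> complex) \<Rightarrow> complex" where
  "ip S \<phi> \<psi> = (\<Sum>i\<in>S. cnj (\<phi> i) * \<psi> i)"

definition nrm :: "'a set \<Rightarrow> ('a \<Rightarrow> complex) \<Rightarrow> real" where
  "nrm S \<psi> = L2_set (\<lambda>i. cmod (\<psi> i)) S"

lemma nrm_nonneg [simp]: "nrm S \<psi> \<ge> 0"
  by (simp add: nrm_def)

lemma nrm_sq: "(nrm S \<psi>)\<^sup>2 = (\<Sum>i\<in>S. (cmod (\<psi> i))\<^sup>2)"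
  by (simp add: nrm_def L2_set_def sum_nonneg)

lemma ip_self: "ip S \<psi> \<psi> = of_real ((nrm S \<psi>)\<^sup>2)"
  unfolding ip_def nrm_sq of_real_sum by (intro sum.cong refl) (metis complex_norm_square mult.commute)

lemma ip_bound: "cmod (ip S \<phi> \<psi>) \<le> nrm S \<phi> * nrm S \<psi>"
proof -
  have "cmod (ip S \<phi> \<psi>) \<le> (\<Sum>i\<in>S. cmod (\<phi> i) * cmod (\<psi> i))"
    unfolding ip_def by (rule order_trans[OF norm_sum]) (simp add: norm_mult)
  also have "\<dots> \<le> nrm S \<phi> * nrm S \<psi>"
    unfolding nrm_def using L2_set_mult_ineq[of "\<lambda>i. cmod (\<phi> i)" "\<lambda>i. cmod (\<psi> i)" S] by simp
  finally show ?thesis .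
qed

lemma nrm_triangle: "nrm S (\<lambda>i. \<phi> i + \<psi> i) \<le> nrm S \<phi> + nrm S \<psi>"
proof -
  have "nrm S (\<lambda>i. \<phi> i + \<psi> i) \<le> L2_set (\<lambda>i. cmod (\<phi> i) + cmod (\<psi> i)) S"
    unfolding nrm_def by (rule L2_set_mono) (auto intro: norm_triangle_ineq)
  also have "\<dots> \<le> nrm S \<phi> + nrm S \<psi>"
    unfolding nrm_def by (rule L2_set_triangle_ineq)
  finally show ?thesis .
qed

lemma nrm_scale: "nrm S (\<lambda>i. c * \<psi> i) = cmod c * nrm S \<psi>"
  by (simp add: nrm_def norm_mult L2_set_right_distrib)

lemma nrm_sum_le: "nrm S (\<lambda>i. \<Sum>j<(n::nat). F j i) \<le> (\<Sum>j<n. nrm S (F j))"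
proof (induction n)
  case 0
  then show ?case by (simp add: nrm_def L2_set_def)
next
  case (Suc n)
  then show ?case
    using nrm_triangle[of S "\<lambda>i. \<Sum>j<n. F j i" "F n"] by simp
qed

text \<open>Vectors are total functions, but the inner product sees only their values on
  \<open>S\<close>. Linearity is stated for whole functions, so fixed-point equations used with it
  have to hold outside \<open>S\<close> as well.\<close>

definition linear_isometry :: "'a set \<Rightarrow> (('a \<Rightarrow> complex) \<Rightarrow> ('a \<Rightarrow> complex)) \<Rightarrow> bool" where
  "linear_isometry S W \<longleftrightarrow>
     (\<forall>a b \<phi> \<psi>. W (\<lambda>i. a * \<phi> i + b * \<psi> i) = (\<lambda>i. a * W \<phi> i + b * W \<psi> i)) \<and>
     (\<forall>\<phi> \<psi>. ip S (W \<phi>) (W \<psi>) = ip S \<phi> \<psi>)"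

lemma isometry_lin:
  "linear_isometry S W \<Longrightarrow> W (\<lambda>i. a * \<phi> i + b * \<psi> i) = (\<lambda>i. a * W \<phi> i + b * W \<psi> i)"
  by (simp add: linear_isometry_def)

lemma isometry_ip: "linear_isometry S W \<Longrightarrow> ip S (W \<phi>) (W \<psi>) = ip S \<phi> \<psi>"
  by (simp add: linear_isometry_def)

lemma isometry_nrm: "linear_isometry S W \<Longrightarrow> nrm S (W \<psi>) = nrm S \<psi>"
proof -
  assume "linear_isometry S W"
  then have "ip S (W \<psi>) (W \<psi>) = ip S \<psi> \<psi>" by (rule isometry_ip)
  then have "(nrm S (W \<psi>))\<^sup>2 = (nrm S \<psi>)\<^sup>2" unfolding ip_self by (simp only: of_real_eq_iff)
  then show ?thesis by (simp add: power2_eq_iff_nonneg)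
qed

lemma isometry_comp:
  "linear_isometry S V \<Longrightarrow> linear_isometry S W \<Longrightarrow> linear_isometry S (\<lambda>\<psi>. V (W \<psi>))"
  by (simp add: linear_isometry_def)

lemma isometry_funpow: "linear_isometry S W \<Longrightarrow> linear_isometry S (W ^^ n)"
  by (induction n) (simp_all add: linear_isometry_def)

lemma isometry_add:
  assumes "linear_isometry S W"
  shows "W (\<lambda>i. \<phi> i + \<psi> i) = (\<lambda>i. W \<phi> i + W \<psi> i)"
  using isometry_lin[OF assms, of 1 \<phi> 1 \<psi>] by simp

lemma isometry_diff:
  assumes "linear_isometry S W"
  shows "W (\<lambda>i. \<phi> i - \<psi> i) = (\<lambda>i. W \<phi> i - W \<psi> i)"
  using isometry_lin[OF assms, of 1 \<phi> "-1" \<psi>] by simp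

definition cesaro ::
  "(('a \<Rightarrow> complex) \<Rightarrow> ('a \<Rightarrow> complex)) \<Rightarrow> nat \<Rightarrow> ('a \<Rightarrow> complex) \<Rightarrow> ('a \<Rightarrow> complex)" where
  "cesaro W K \<psi> = (\<lambda>i. (1 / of_nat K) * (\<Sum>j<K. (W ^^ j) \<psi> i))"

text \<open>Every iterate of \<open>\<psi>\<close>, hence also the average, has the same overlap
  with the fixed vector \<open>\<phi>\<close>; Cauchy-Schwarz does the rest.\<close>

lemma cesaro_fixed_lower_bound:
  assumes W: "linear_isometry S W" and fix_W: "W \<phi> = \<phi>" and "K > 0"
  shows "(cmod (ip S \<phi> \<psi>))\<^sup>2 \<le> (nrm S \<phi>)\<^sup>2 * (nrm S (cesaro W K \<psi>))\<^sup>2"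
proof -
  have pow: "(W ^^ j) \<phi> = \<phi>" for j
    by (induction j) (simp_all add: fix_W)
  have j: "ip S \<phi> ((W ^^ j) \<psi>) = ip S \<phi> \<psi>" for j
    using isometry_ip[OF isometry_funpow[OF W, of j], of \<phi> \<psi>] by (simp add: pow)
  have "ip S \<phi> (cesaro W K \<psi>) = (1 / of_nat K) * (\<Sum>j<K. ip S \<phi> ((W ^^ j) \<psi>))"
    unfolding ip_def cesaro_def by (subst sum.swap) (simp add: sum_distrib_left mult_ac)
  also have "\<dots> = ip S \<phi> \<psi>"
    using \<open>K > 0\<close> by (simp add: j)
  finally have "cmod (ip S \<phi> \<psi>) \<le> nrm S \<phi> * nrm S (cesaro W K \<psi>)"
    using ip_bound[of S \<phi> "cesaro W K \<psi>"] by simp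
  then show ?thesis
    by (metis norm_ge_zero power_mono power_mult_distrib)
qed

text \<open>\<open>W \<phi> - \<phi>\<close> telescopes along the orbit to two vectors as long as
  \<open>\<phi>\<close>, which are then divided by \<open>K\<close>. The defect
  \<open>\<delta>\<close> enters once per iterate, so averaging does not amplify it.\<close>

lemma cesaro_coboundary_upper_bound:
  assumes W: "linear_isometry S W" and "K > 0"
    and eq: "\<psi> = (\<lambda>i. W \<phi> i - \<phi> i + \<delta> i)"
  shows "nrm S (cesaro W K \<psi>) \<le> 2 * nrm S \<phi> / K + nrm S \<delta>"
proof -
  have pow: "(W ^^ j) \<psi> = (\<lambda>i. (W ^^ Suc j) \<phi> i - (W ^^ j) \<phi> i + (W ^^ j) \<delta> i)" for j
  proof -
    note P = isometry_funpow[OF W, of j]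
    have "(W ^^ j) \<psi> = (\<lambda>i. (W ^^ j) (W \<phi>) i - (W ^^ j) \<phi> i + (W ^^ j) \<delta> i)"
      unfolding eq isometry_add[OF P] isometry_diff[OF P] ..
    then show ?thesis by (simp add: funpow_swap1)
  qed
  have tele: "(\<Sum>j<K. (W ^^ j) \<psi> i) = (W ^^ K) \<phi> i - \<phi> i + (\<Sum>j<K. (W ^^ j) \<delta> i)" for i
  proof -
    have "(\<Sum>j<K. (W ^^ Suc j) \<phi> i - (W ^^ j) \<phi> i) = (W ^^ K) \<phi> i - (W ^^ 0) \<phi> i"
      by (rule sum_lessThan_telescope)
    then show ?thesis by (simp add: pow sum.distrib)
  qed
  have "nrm S (\<lambda>i. \<Sum>j<K. (W ^^ j) \<psi> i)
      \<le> nrm S (\<lambda>i. (W ^^ K) \<phi> i + (- 1) * \<phi> i) + nrm S (\<lambda>i. \<Sum>j<K. (W ^^ j) \<delta> i)"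
    using nrm_triangle[of S "\<lambda>i. (W ^^ K) \<phi> i - \<phi> i"] by (simp add: tele)
  also have "\<dots> \<le> (nrm S ((W ^^ K) \<phi>) + nrm S \<phi>) + (\<Sum>j<K. nrm S ((W ^^ j) \<delta>))"
    using nrm_triangle[of S "(W ^^ K) \<phi>" "\<lambda>i. (-1) * \<phi> i"] nrm_sum_le[of S "\<lambda>j. (W ^^ j) \<delta>" K]
    unfolding nrm_scale by simp
  also have "\<dots> = 2 * nrm S \<phi> + K * nrm S \<delta>"
    by (simp add: isometry_nrm[OF isometry_funpow[OF W]])
  finally have "(1 / K) * nrm S (\<lambda>i. \<Sum>j<K. (W ^^ j) \<psi> i) \<le> (1 / K) * (2 * nrm S \<phi> + K * nrm S \<delta>)"
    by (rule mult_left_mono) simp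
  moreover have "nrm S (cesaro W K \<psi>) = (1 / K) * nrm S (\<lambda>i. \<Sum>j<K. (W ^^ j) \<psi> i)"
    unfolding cesaro_def nrm_scale by (simp add: norm_divide)
  moreover have "(1 / K) * (2 * nrm S \<phi> + K * nrm S \<delta>) = 2 * nrm S \<phi> / K + nrm S \<delta>"
    using \<open>K > 0\<close> by (simp add: field_simps)
  ultimately show ?thesis by simp
qed

section \<open>Unitary matrices acting on vectors: adjoints, reflections, permutations\<close>

lemma apply_op_cong:
  assumes "\<And>i. i \<in> S \<Longrightarrow> \<phi> i = \<psi> i"
  shows "apply_op S U \<phi> = apply_op S U \<psi>"
  using assms by (auto simp: apply_op_def intro!: sum.cong)

lemma sum_delta_prod:
  assumes "finite S" "i \<in> S"
  shows "(\<Sum>j\<in>S. (if i = j then 1 else 0) * (f j :: complex)) = f i"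
    and "(\<Sum>j\<in>S. f j * (if i = j then 1 else 0)) = f i"
    and "(\<Sum>j\<in>S. f j * (if j = i then 1 else 0)) = f i"
  using assms by (simp_all add: if_distrib if_distribR cong: if_cong)

lemma unitary_isometry:
  assumes fin: "finite S" and U: "is_unitary_on S U"
  shows "linear_isometry S (apply_op S U)"
proof -
  have "ip S (apply_op S U \<phi>) (apply_op S U \<psi>) = ip S \<phi> \<psi>" for \<phi> \<psi>
  proof -
    have "ip S (apply_op S U \<phi>) (apply_op S U \<psi>)
        = (\<Sum>k\<in>S. \<Sum>i\<in>S. \<Sum>j\<in>S. cnj (\<phi> i) * \<psi> j * (cnj (U k i) * U k j))"
      unfolding ip_def
      by (intro sum.cong refl) (simp add: apply_op_def cnj_sum sum_product, intro sum.cong refl, simp add: mult_ac)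
    also have "\<dots> = (\<Sum>i\<in>S. \<Sum>k\<in>S. \<Sum>j\<in>S. cnj (\<phi> i) * \<psi> j * (cnj (U k i) * U k j))"
      by (rule sum.swap)
    also have "\<dots> = (\<Sum>i\<in>S. \<Sum>j\<in>S. \<Sum>k\<in>S. cnj (\<phi> i) * \<psi> j * (cnj (U k i) * U k j))"
      by (rule sum.cong[OF refl], rule sum.swap)
    also have "\<dots> = (\<Sum>i\<in>S. \<Sum>j\<in>S. cnj (\<phi> i) * \<psi> j * (if i = j then 1 else 0))"
      using U by (simp add: is_unitary_on_def flip: sum_distrib_left)
    also have "\<dots> = ip S \<phi> \<psi>"
      unfolding ip_def using fin by (intro sum.cong refl) (simp add: sum_delta_prod)
    finally show ?thesis .
  qed
  moreover have "apply_op S U (\<lambda>i. a * \<phi> i + b * \<psi> i)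
      = (\<lambda>i. a * apply_op S U \<phi> i + b * apply_op S U \<psi> i)" for a b \<phi> \<psi>
    by (auto simp: apply_op_def fun_eq_iff sum.distrib sum_distrib_left algebra_simps)
  ultimately show ?thesis by (simp add: linear_isometry_def)
qed

text \<open>If the columns of \<open>U\<close> are orthonormal then \<open>P = U U\<^sup>\<dagger>\<close> has trace and squared
  Hilbert--Schmidt norm both equal to the dimension, which forces \<open>P = 1\<close>.\<close>

lemma unitary_adj:
  assumes fin: "finite S" and U: "is_unitary_on S U"
  shows "is_unitary_on S (adj U)"
proof -
  define P where "P = (\<lambda>i k. \<Sum>j\<in>S. U i j * cnj (U k j))"
  define d where "d = (\<lambda>i k :: 'a. if i = k then 1 else 0 :: complex)"
  have orth: "(\<Sum>k\<in>S. cnj (U k i) * U k j) = d i j" if "i \<in> S" "j \<in> S" for i j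
    using U that by (simp add: is_unitary_on_def d_def)
  have tr: "(\<Sum>i\<in>S. P i i) = of_nat (card S)"
  proof -
    have "(\<Sum>i\<in>S. P i i) = (\<Sum>j\<in>S. \<Sum>i\<in>S. cnj (U i j) * U i j)"
      unfolding P_def by (subst sum.swap) (simp add: mult.commute)
    also have "\<dots> = (\<Sum>j\<in>S. d j j)" by (simp add: orth)
    finally show ?thesis by (simp add: d_def)
  qed
  have hs: "(\<Sum>i\<in>S. \<Sum>k\<in>S. P i k * cnj (P i k)) = of_nat (card S)"
  proof -
    have "(\<Sum>i\<in>S. \<Sum>k\<in>S. P i k * cnj (P i k))
        = (\<Sum>i\<in>S. \<Sum>k\<in>S. \<Sum>j\<in>S. \<Sum>l\<in>S. (cnj (U i l) * U i j) * (cnj (U k j) * U k l))"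
      by (simp add: P_def sum_product mult_ac)
    also have "\<dots> = (\<Sum>i\<in>S. \<Sum>j\<in>S. \<Sum>k\<in>S. \<Sum>l\<in>S. (cnj (U i l) * U i j) * (cnj (U k j) * U k l))"
      by (rule sum.cong[OF refl], rule sum.swap)
    also have "\<dots> = (\<Sum>i\<in>S. \<Sum>j\<in>S. \<Sum>l\<in>S. \<Sum>k\<in>S. (cnj (U i l) * U i j) * (cnj (U k j) * U k l))"
      by (rule sum.cong[OF refl], rule sum.cong[OF refl], rule sum.swap)
    also have "\<dots> = (\<Sum>i\<in>S. \<Sum>j\<in>S. \<Sum>l\<in>S. (cnj (U i l) * U i j) * d j l)"
      by (simp add: orth flip: sum_distrib_left)
    also have "\<dots> = (\<Sum>i\<in>S. \<Sum>j\<in>S. cnj (U i j) * U i j)"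
      using fin by (intro sum.cong refl) (simp add: d_def sum_delta_prod)
    also have "\<dots> = (\<Sum>j\<in>S. d j j)"
      by (subst sum.swap) (simp add: orth)
    finally show ?thesis by (simp add: d_def)
  qed
  have "complex_of_real (\<Sum>i\<in>S. \<Sum>k\<in>S. (cmod (P i k - d i k))\<^sup>2)
      = (\<Sum>i\<in>S. \<Sum>k\<in>S. (P i k * cnj (P i k) + d i k) - P i k * d i k - cnj (P i k) * d i k)"
    unfolding of_real_sum
    by (intro sum.cong refl) (auto simp: complex_norm_square d_def algebra_simps simp del: of_real_power)
  also have "\<dots> = (\<Sum>i\<in>S. \<Sum>k\<in>S. P i k * cnj (P i k)) + (\<Sum>i\<in>S. \<Sum>k\<in>S. d i k)
       - (\<Sum>i\<in>S. \<Sum>k\<in>S. P i k * d i k) - (\<Sum>i\<in>S. \<Sum>k\<in>S. cnj (P i k) * d i k)"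
    by (simp add: sum.distrib sum_subtractf)
  also have "\<dots> = of_nat (card S) + (\<Sum>i\<in>S. 1) - (\<Sum>i\<in>S. P i i) - cnj (\<Sum>i\<in>S. P i i)"
    using fin by (simp add: hs d_def sum_delta_prod)
  also have "\<dots> = 0" by (simp add: tr)
  finally have "(\<Sum>i\<in>S. \<Sum>k\<in>S. (cmod (P i k - d i k))\<^sup>2) = 0" by (simp only: of_real_eq_0_iff)
  then have P: "P i k = d i k" if "i \<in> S" "k \<in> S" for i k
    using fin that by (simp add: sum_nonneg_eq_0_iff sum_nonneg)
  show ?thesis
    unfolding is_unitary_on_def
  proof (intro ballI)
    fix i j assume ij: "i \<in> S" "j \<in> S"
    then show "(\<Sum>k\<in>S. cnj (adj U k i) * adj U k j) = (if i = j then 1 else 0)"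
      using P[OF ij] by (simp add: P_def d_def adj_def)
  qed
qed

lemma adj_adj [simp]: "adj (adj U) = U"
  by (simp add: adj_def)

lemma apply_adj_cancel:
  assumes fin: "finite S" and U: "is_unitary_on S U" and i: "i \<in> S"
  shows "apply_op S (adj U) (apply_op S U \<psi>) i = \<psi> i"
proof -
  have "apply_op S (adj U) (apply_op S U \<psi>) i = (\<Sum>k\<in>S. \<Sum>j\<in>S. (cnj (U k i) * U k j) * \<psi> j)"
    using i by (simp add: apply_op_def adj_def sum_distrib_left mult_ac)
  also have "\<dots> = (\<Sum>j\<in>S. (if i = j then 1 else 0) * \<psi> j)"
    using U i by (subst sum.swap) (simp add: is_unitary_on_def flip: sum_distrib_right)
  finally show ?thesis using fin i by (simp add: sum_delta_prod)
qed

lemma apply_op_adj_cancel: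
  assumes "finite S" "is_unitary_on S U" "i \<in> S"
  shows "apply_op S U (apply_op S (adj U) \<psi>) i = \<psi> i"
  using apply_adj_cancel[OF assms(1) unitary_adj[OF assms(1,2)] assms(3)] by simp

definition reflection :: "('a \<Rightarrow> real) \<Rightarrow> ('a \<Rightarrow> real) \<Rightarrow> 'a \<Rightarrow> 'a \<Rightarrow> complex" where
  "reflection \<kappa> g i j = of_real (2 * \<kappa> i * \<kappa> j + (if i = j then g i else 0))"

text \<open>The matrix is real and symmetric, and \<open>g\<close> is -1 on the support of
  \<open>\<kappa>\<close>. In its square the rank-one part has coefficient 4 - 2 - 2 = 0 and the
  diagonal is 1. Off the support \<open>g\<close> may be any sign, so one gate can both reflect and
  apply signs.\<close>

lemma unitary_reflection:
  assumes fin: "finite S" and unit: "(\<Sum>i\<in>S. (\<kappa> i)\<^sup>2) = 1"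
    and g: "\<And>i. i \<in> S \<Longrightarrow> (g i)\<^sup>2 = 1" "\<And>i. i \<in> S \<Longrightarrow> \<kappa> i \<noteq> 0 \<Longrightarrow> g i = - 1"
  shows "is_unitary_on S (reflection \<kappa> g)"
  unfolding is_unitary_on_def
proof (intro ballI)
  fix i j assume ij: "i \<in> S" "j \<in> S"
  have gchi: "g k * \<kappa> k = - \<kappa> k" if "k \<in> S" for k
    using g(2)[OF that] by (cases "\<kappa> k = 0") auto
  have "(\<Sum>k\<in>S. (2 * \<kappa> k * \<kappa> i + (if k = i then g k else 0)) * (2 * \<kappa> k * \<kappa> j + (if k = j then g k else 0)))
     = (\<Sum>k\<in>S. 4 * \<kappa> i * \<kappa> j * (\<kappa> k)\<^sup>2 + (if k = i then 2 * \<kappa> j * (g k * \<kappa> k) else 0)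
         + (if k = j then 2 * \<kappa> i * (g k * \<kappa> k) else 0) + (if k = i then if i = j then (g k)\<^sup>2 else 0 else 0))"
    by (intro sum.cong refl) (auto simp: algebra_simps power2_eq_square)
  also have "\<dots> = (if i = j then 1 else 0)"
    using fin ij by (simp add: sum.distrib unit gchi g(1) flip: sum_distrib_left)
  finally have eq: "(\<Sum>k\<in>S. (2 * \<kappa> k * \<kappa> i + (if k = i then g k else 0)) * (2 * \<kappa> k * \<kappa> j + (if k = j then g k else 0)))
     = (if i = j then 1 else 0)" .
  have "(\<Sum>k\<in>S. cnj (reflection \<kappa> g k i) * reflection \<kappa> g k j)
    = of_real (\<Sum>k\<in>S. (2 * \<kappa> k * \<kappa> i + (if k = i then g k else 0)) * (2 * \<kappa> k * \<kappa> j + (if k = j then g k else 0)))"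
    unfolding reflection_def complex_cnj_complex_of_real of_real_sum of_real_mult ..
  then show "(\<Sum>k\<in>S. cnj (reflection \<kappa> g k i) * reflection \<kappa> g k j) = (if i = j then 1 else 0)"
    unfolding eq by simp
qed

lemma apply_reflection:
  assumes "finite S" "i \<in> S"
  shows "apply_op S (reflection \<kappa> g) \<psi> i
    = 2 * of_real (\<kappa> i) * (\<Sum>j\<in>S. of_real (\<kappa> j) * \<psi> j) + of_real (g i) * \<psi> i"
proof -
  have "apply_op S (reflection \<kappa> g) \<psi> i
     = (\<Sum>j\<in>S. 2 * of_real (\<kappa> i) * (of_real (\<kappa> j) * \<psi> j) + (if i = j then of_real (g i) * \<psi> j else 0))"
    using assms by (auto simp: apply_op_def reflection_def algebra_simps intro!: sum.cong)
  then show ?thesis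
    using assms by (simp add: sum.distrib flip: sum_distrib_left)
qed

text \<open>For a self-inverse map this permutation matrix is symmetric, so pulling amplitudes back
  along \<open>\<pi>\<close> and moving basis states along \<open>\<pi>\<close> agree.\<close>

definition involution :: "('a \<Rightarrow> 'a) \<Rightarrow> 'a \<Rightarrow> 'a \<Rightarrow> complex" where
  "involution \<pi> i j = (if j = \<pi> i then 1 else 0)"

lemma apply_involution:
  assumes "finite S" "i \<in> S" "\<pi> i \<in> S"
  shows "apply_op S (involution \<pi>) \<psi> i = \<psi> (\<pi> i)"
proof -
  have "apply_op S (involution \<pi>) \<psi> i = (\<Sum>j\<in>S. if j = \<pi> i then \<psi> j else 0)"
    unfolding apply_op_def involution_def using assms(2) by (simp, intro sum.cong) auto
  then show ?thesis using assms by simp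
qed

lemma unitary_involution:
  assumes fin: "finite S" and \<pi>: "\<And>i. i \<in> S \<Longrightarrow> \<pi> i \<in> S" "\<And>i. i \<in> S \<Longrightarrow> \<pi> (\<pi> i) = i"
  shows "is_unitary_on S (involution \<pi>)"
  unfolding is_unitary_on_def
proof (intro ballI)
  fix i j assume ij: "i \<in> S" "j \<in> S"
  have "(\<Sum>k\<in>S. cnj (involution \<pi> k i) * involution \<pi> k j)
      = (\<Sum>k\<in>S. if k = \<pi> i then (if i = j then 1 else 0) else 0)"
    by (rule sum.cong) (use \<pi> ij in \<open>auto simp: involution_def\<close>)
  then show "(\<Sum>k\<in>S. cnj (involution \<pi> k i) * involution \<pi> k j) = (if i = j then 1 else 0)"
    using fin \<pi>(1)[OF ij(1)] by simp
qed

lemma unitary_identity: "finite S \<Longrightarrow> is_unitary_on S (involution id)"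
  by (rule unitary_involution) auto

section \<open>Orbit averages as output probabilities\<close>

lemma finite_basis [simp]: "finite (basis N m q)"
  by (simp add: basis_def)

lemma zero_in_basis [simp]: "N \<ge> 1 \<Longrightarrow> (0, 0, 0) \<in> basis N m q"
  by (simp add: basis_def)

lemma sum_basis: "(\<Sum>i\<in>basis N m q. f i) = (\<Sum>x<N. \<Sum>r<2^m. \<Sum>a<2^q. f (x, r, a))"
  unfolding basis_def lessThan_atLeast0 sum.cartesian_product by (simp add: case_prod_unfold)

text \<open>The ancilla register carries two data: a counter \<open>j\<close> in the high bits and a
  line value \<open>l\<close> below \<open>H\<close> in the low bits. A layer consists of the states
  with one counter value.\<close>

definition emb :: "nat \<Rightarrow> nat \<Rightarrow> idx \<Rightarrow> idx" where
  "emb H j = (\<lambda>(x, r, l). (x, r, j * H + l))"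

definition layer :: "nat \<Rightarrow> idx \<Rightarrow> nat" where
  "layer H = (\<lambda>(x, r, a). a div H)"

definition proj :: "nat \<Rightarrow> idx \<Rightarrow> idx" where
  "proj H = (\<lambda>(x, r, a). (x, r, a mod H))"

definition blk :: "nat \<Rightarrow> (nat \<Rightarrow> idx \<Rightarrow> idx \<Rightarrow> complex) \<Rightarrow> idx \<Rightarrow> idx \<Rightarrow> complex" where
  "blk H M i i' = (if layer H i = layer H i' then M (layer H i) (proj H i) (proj H i') else 0)"

definition tens :: "nat \<Rightarrow> (nat \<Rightarrow> nat \<Rightarrow> complex) \<Rightarrow> idx \<Rightarrow> idx \<Rightarrow> complex" where
  "tens H F i i' = (if proj H i = proj H i' then F (layer H i) (layer H i') else 0)"

lemma layer_emb: "i \<in> basis N m h \<Longrightarrow> layer (2^h) (emb (2^h) j i) = j"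
  by (auto simp: layer_def emb_def basis_def)

lemma proj_emb: "i \<in> basis N m h \<Longrightarrow> proj (2^h) (emb (2^h) j i) = i"
  by (auto simp: proj_def emb_def basis_def)

lemma emb_bij: "bij_betw (\<lambda>(j, i). emb (2^h) j i) ({..<2^s} \<times> basis N m h) (basis N m (s + h))"
proof (rule bij_betw_byWitness[where f' = "\<lambda>i. (layer (2^h) i, proj (2^h) i)"])
  show "\<forall>a\<in>{..<2^s} \<times> basis N m h. (\<lambda>i. (layer (2^h) i, proj (2^h) i)) ((\<lambda>(j, i). emb (2^h) j i) a) = a"
    by (auto simp: layer_emb[where N = N and m = m] proj_emb[where N = N and m = m])
  show "\<forall>a'\<in>basis N m (s + h). (\<lambda>(j, i). emb (2^h) j i) (layer (2^h) a', proj (2^h) a') = a'"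
    by (auto simp: layer_def emb_def proj_def basis_def div_mult_mod_eq)
  show "(\<lambda>(j, i). emb (2^h) j i) ` ({..<2^s} \<times> basis N m h) \<subseteq> basis N m (s + h)"
  proof (clarsimp simp: basis_def emb_def)
    fix j l :: nat assume "j < 2^s" "l < 2^h"
    then have "j * 2^h + l < (j + 1) * 2^h" by simp
    also have "\<dots> \<le> 2^s * 2^h" using \<open>j < 2^s\<close> by (intro mult_right_mono) auto
    finally show "j * 2^h + l < 2^(s + h)" by (simp add: power_add)
  qed
  show "(\<lambda>i. (layer (2^h) i, proj (2^h) i)) ` basis N m (s + h) \<subseteq> {..<2^s} \<times> basis N m h"
    by (auto simp: layer_def proj_def basis_def power_add less_mult_imp_div_less)
qed

lemma sum_layers:
  "(\<Sum>i\<in>basis N m (s + h). f i) = (\<Sum>j<2^s. \<Sum>i\<in>basis N m h. f (emb (2^h) j i))"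
  by (simp add: sum.reindex_bij_betw[OF emb_bij, symmetric] sum.cartesian_product case_prod_unfold)

lemma emb_in_basis [simp]: "j < 2^s \<Longrightarrow> i \<in> basis N m h \<Longrightarrow> emb (2^h) j i \<in> basis N m (s + h)"
  using bij_betw_apply[OF emb_bij[of h s N m], of "(j, i)"] by simp

lemma basis_emb_cases:
  assumes "i \<in> basis N m (s + h)"
  obtains j k where "j < 2^s" "k \<in> basis N m h" "i = emb (2^h) j k"
  using assms bij_betw_imp_surj_on[OF emb_bij[of h s N m]] by (force simp: image_iff)

lemma emb_eq_iff:
  assumes "i \<in> basis N m h" "i' \<in> basis N m h"
  shows "emb (2^h) j i = emb (2^h) j' i' \<longleftrightarrow> j = j' \<and> i = i'"
  by (metis assms layer_emb proj_emb)

text \<open>Only the row of the point considered is constrained. This covers both gates whose block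
  changes with the counter and the oracle, whose block is the same in every layer.\<close>

lemma apply_block:
  assumes "\<And>j'. j' < 2^s \<Longrightarrow> (\<And>i'. i' \<in> basis N m h \<Longrightarrow>
      U (emb (2^h) j i) (emb (2^h) j' i') = (if j = j' then M i i' else 0))"
    and "j < 2^s" "i \<in> basis N m h"
  shows "apply_op (basis N m (s + h)) U \<Psi> (emb (2^h) j i)
    = apply_op (basis N m h) M (\<lambda>i. \<Psi> (emb (2^h) j i)) i"
proof -
  have "apply_op (basis N m (s + h)) U \<Psi> (emb (2^h) j i)
    = (\<Sum>j'<2^s. \<Sum>i'\<in>basis N m h. U (emb (2^h) j i) (emb (2^h) j' i') * \<Psi> (emb (2^h) j' i'))"
    using assms(2,3) by (simp add: apply_op_def sum_layers)
  also have "\<dots> = (\<Sum>j'<2^s. if j = j' then \<Sum>i'\<in>basis N m h. M i i' * \<Psi> (emb (2^h) j' i') else 0)"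
    by (intro sum.cong refl) (simp add: assms(1))
  also have "\<dots> = apply_op (basis N m h) M (\<lambda>i. \<Psi> (emb (2^h) j i)) i"
    using assms(2,3) by (simp add: apply_op_def)
  finally show ?thesis .
qed

lemma apply_blk:
  assumes "j < 2^s" "i \<in> basis N m h"
  shows "apply_op (basis N m (s + h)) (blk (2^h) M) \<Psi> (emb (2^h) j i)
    = apply_op (basis N m h) (M j) (\<lambda>i. \<Psi> (emb (2^h) j i)) i"
  by (rule apply_block) (use assms in \<open>auto simp: blk_def layer_emb[where N = N and m = m] proj_emb[where N = N and m = m]\<close>)

lemma apply_tens:
  assumes "j < 2^s" "i \<in> basis N m h"
  shows "apply_op (basis N m (s + h)) (tens (2^h) F) \<Psi> (emb (2^h) j i)
    = (\<Sum>j'<2^s. F j j' * \<Psi> (emb (2^h) j' i))"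
proof -
  have "apply_op (basis N m (s + h)) (tens (2^h) F) \<Psi> (emb (2^h) j i)
    = (\<Sum>j'<2^s. \<Sum>i'\<in>basis N m h. if i = i' then F j j' * \<Psi> (emb (2^h) j' i') else 0)"
    using assms unfolding apply_op_def sum_layers tens_def
    by (simp only: emb_in_basis if_True, intro sum.cong refl) (auto simp: layer_emb[where N = N and m = m] proj_emb[where N = N and m = m])
  then show ?thesis using assms by simp
qed

lemma unitary_blk:
  assumes "\<And>j. j < 2^s \<Longrightarrow> is_unitary_on (basis N m h) (M j)"
  shows "is_unitary_on (basis N m (s + h)) (blk (2^h) M)"
  unfolding is_unitary_on_def
proof (intro ballI)
  fix i i' assume "i \<in> basis N m (s + h)" "i' \<in> basis N m (s + h)"
  then obtain j k j' k' where *: "j < 2^s" "k \<in> basis N m h" "i = emb (2^h) j k"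
     "j' < 2^s" "k' \<in> basis N m h" "i' = emb (2^h) j' k'"
    by (metis basis_emb_cases)
  have "(\<Sum>n\<in>basis N m (s + h). cnj (blk (2^h) M n i) * blk (2^h) M n i')
     = (\<Sum>l<2^s. \<Sum>n\<in>basis N m h. if l = j then cnj (M j n k) * (if j = j' then M j n k' else 0) else 0)"
    unfolding sum_layers using * by (intro sum.cong refl) (auto simp: blk_def layer_emb[where N = N and m = m] proj_emb[where N = N and m = m])
  also have "\<dots> = (\<Sum>l<2^s. if l = j then \<Sum>n\<in>basis N m h. cnj (M j n k) * (if j = j' then M j n k' else 0) else 0)"
    by (intro sum.cong refl) simp
  also have "\<dots> = (if i = i' then 1 else 0)"
    using * assms[OF *(1)] by (cases "j = j'") (simp_all add: is_unitary_on_def emb_eq_iff[where N = N and m = m])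
  finally show "(\<Sum>n\<in>basis N m (s + h). cnj (blk (2^h) M n i) * blk (2^h) M n i')
     = (if i = i' then 1 else 0)" .
qed

lemma unitary_tens:
  assumes "is_unitary_on {..<2^s} F"
  shows "is_unitary_on (basis N m (s + h)) (tens (2^h) F)"
  unfolding is_unitary_on_def
proof (intro ballI)
  fix i i' assume "i \<in> basis N m (s + h)" "i' \<in> basis N m (s + h)"
  then obtain j k j' k' where *: "j < 2^s" "k \<in> basis N m h" "i = emb (2^h) j k"
     "j' < 2^s" "k' \<in> basis N m h" "i' = emb (2^h) j' k'"
    by (metis basis_emb_cases)
  have "(\<Sum>n\<in>basis N m (s + h). cnj (tens (2^h) F n i) * tens (2^h) F n i')
     = (\<Sum>l<2^s. \<Sum>n\<in>basis N m h. if n = k then (if k = k' then cnj (F l j) * F l j' else 0) else 0)"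
    unfolding sum_layers using * by (intro sum.cong refl) (auto simp: tens_def layer_emb[where N = N and m = m] proj_emb[where N = N and m = m])
  also have "\<dots> = (if k = k' then \<Sum>l<2^s. cnj (F l j) * F l j' else 0)"
    using * by simp
  also have "\<dots> = (if i = i' then 1 else 0)"
    using * assms by (auto simp: is_unitary_on_def emb_eq_iff)
  finally show "(\<Sum>n\<in>basis N m (s + h). cnj (tens (2^h) F n i) * tens (2^h) F n i')
     = (if i = i' then 1 else 0)" .
qed

text \<open>The oracle is the identity on the whole ancilla and so preserves the counter: each query
  acts in all layers at once, uncontrolled.\<close>

lemma lift_oracle_emb:
  assumes "i \<in> basis N m h" "i' \<in> basis N m h"
  shows "lift_oracle Orc (emb (2^h) j i) (emb (2^h) j' i') = (if j = j' then lift_oracle Orc i i' else 0)"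
proof -
  obtain x r l x' r' l' where i: "i = (x, r, l)" "i' = (x', r', l')"
    by (metis prod_cases3)
  have "emb (2^h) j (0, 0, l) = emb (2^h) j' (0, 0, l') \<longleftrightarrow> j = j' \<and> (0 :: nat, 0 :: nat, l) = (0, 0, l')"
    by (rule emb_eq_iff[of _ 1 0]) (use assms i in \<open>auto simp: basis_def\<close>)
  then show ?thesis by (auto simp: i lift_oracle_def emb_def)
qed

lemma apply_lift_oracle:
  assumes "j < 2^s" "i \<in> basis N m h"
  shows "apply_op (basis N m (s + h)) (lift_oracle Orc) \<Psi> (emb (2^h) j i)
    = apply_op (basis N m h) (lift_oracle Orc) (\<lambda>i. \<Psi> (emb (2^h) j i)) i"
    and "apply_op (basis N m (s + h)) (adj (lift_oracle Orc)) \<Psi> (emb (2^h) j i)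
    = apply_op (basis N m h) (adj (lift_oracle Orc)) (\<lambda>i. \<Psi> (emb (2^h) j i)) i"
  by (rule apply_block; use assms in \<open>simp add: adj_def lift_oracle_emb\<close>)+

lemma unitary_lift_oracle:
  assumes "is_unitary_on ({0..<N} \<times> {0..<2^m}) Orc"
  shows "is_unitary_on (basis N m q) (lift_oracle Orc)"
  unfolding is_unitary_on_def
proof (intro ballI)
  fix i j assume ij: "i \<in> basis N m q" "j \<in> basis N m q"
  obtain x r a x' r' a' where i: "i = (x, r, a)" "j = (x', r', a')"
    by (metis prod_cases3)
  have bd: "x < N" "r < 2^m" "a < 2^q" "x' < N" "r' < 2^m" "a' < 2^q"
    using ij by (auto simp: i basis_def)
  have "(\<Sum>k\<in>basis N m q. cnj (lift_oracle Orc k i) * lift_oracle Orc k j)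
     = (\<Sum>y<N. \<Sum>t<2^m. \<Sum>b<2^q. if b = a then (if a = a' then cnj (Orc (y, t) (x, r)) * Orc (y, t) (x', r') else 0) else 0)"
    unfolding sum_basis by (intro sum.cong refl) (auto simp: i lift_oracle_def)
  also have "\<dots> = (if a = a' then (\<Sum>k\<in>{0..<N} \<times> {0..<2^m}. cnj (Orc k (x, r)) * Orc k (x', r')) else 0)"
    using bd by (simp add: sum.cartesian_product[symmetric] lessThan_atLeast0 case_prod_unfold sum.cartesian_product)
  also have "\<dots> = (if i = j then 1 else 0)"
    using assms bd by (auto simp: is_unitary_on_def i)
  finally show "(\<Sum>k\<in>basis N m q. cnj (lift_oracle Orc k i) * lift_oracle Orc k j) = (if i = j then 1 else 0)" .
qed

text \<open>The Householder reflection exchanging the basis vector \<open>0\<close> with the uniform superposition.\<close>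

definition mixer :: "nat \<Rightarrow> nat \<Rightarrow> nat \<Rightarrow> complex" where
  "mixer K = reflection
     (\<lambda>j. ((if j = 0 then 1 else 0) + 1 / sqrt K) / sqrt (2 + 2 / sqrt K)) (\<lambda>_. - 1)"

lemma unitary_mixer:
  assumes "K > 0"
  shows "is_unitary_on {..<K} (mixer K)"
  unfolding mixer_def
proof (rule unitary_reflection)
  define \<kappa> where "\<kappa> = 1 / sqrt K"
  have \<kappa>: "\<kappa> > 0" "K * \<kappa>\<^sup>2 = 1"
    using assms by (simp_all add: \<kappa>_def power_divide)
  have "(\<Sum>j<K. ((if j = 0 then 1 else 0) + \<kappa>)\<^sup>2) = (\<Sum>j<K. (if j = 0 then 1 + 2 * \<kappa> else 0) + \<kappa>\<^sup>2)"
    by (intro sum.cong refl) (auto simp: power2_eq_square algebra_simps)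
  also have "\<dots> = 2 + 2 * \<kappa>"
    using assms \<kappa> by (simp add: sum.distrib)
  finally have "(\<Sum>j<K. ((if j = 0 then 1 else 0) + \<kappa>)\<^sup>2) = 2 + 2 * \<kappa>" .
  moreover have "2 / sqrt K = 2 * \<kappa>" by (simp add: \<kappa>_def)
  ultimately show "(\<Sum>j<K. (((if j = 0 then 1 else 0) + 1 / sqrt K) / sqrt (2 + 2 / sqrt K))\<^sup>2) = 1"
    using \<kappa> by (simp add: power_divide \<kappa>_def[symmetric] sum_divide_distrib[symmetric])
qed simp_all

text \<open>Column 0 prepares the uniform counter at the start; row 0 adds the layers coherently at
  the end.\<close>

lemma mixer_0:
  assumes "K > 0"
  shows "mixer K 0 j = 1 / sqrt K" "mixer K j 0 = 1 / sqrt K"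
proof -
  define \<kappa> where "\<kappa> = 1 / sqrt K"
  have \<kappa>: "\<kappa> > 0" using assms by (simp add: \<kappa>_def)
  have e: "2 / sqrt K = 2 * \<kappa>" by (simp add: \<kappa>_def)
  have r: "2 * ((1 + \<kappa>) / sqrt (2 + 2 * \<kappa>)) * ((d + \<kappa>) / sqrt (2 + 2 * \<kappa>)) - d = \<kappa>" for d
  proof -
    have "sqrt (2 + 2 * \<kappa>) * sqrt (2 + 2 * \<kappa>) = 2 * (1 + \<kappa>)" using \<kappa> by simp
    then have "2 * ((1 + \<kappa>) / sqrt (2 + 2 * \<kappa>)) * ((d + \<kappa>) / sqrt (2 + 2 * \<kappa>)) = 2 * (1 + \<kappa>) * (d + \<kappa>) / (2 * (1 + \<kappa>))"
      by (simp add: divide_simps) 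
    also have "\<dots> = d + \<kappa>" using \<kappa> by simp
    finally show ?thesis by simp
  qed
  show *: "mixer K 0 j = 1 / sqrt K"
    using r[of 1] r[of 0]
    unfolding mixer_def reflection_def e \<kappa>_def[symmetric] by (cases "j = 0") simp_all
  have "mixer K j 0 = mixer K 0 j"
    unfolding mixer_def reflection_def by (rule arg_cong[where f = of_real]) auto
  with * show "mixer K j 0 = 1 / sqrt K" by simp
qed

section \<open>The query circuit and its evolution layer by layer\<close>

definition start :: "idx \<Rightarrow> complex" where
  "start i = (if i = (0, 0, 0) then 1 else 0)"

text \<open>Queries alternate between the oracle and its adjoint; \<open>B\<close> stands inside
  each such pair and \<open>D\<close> after it. In pair \<open>t\<close> these gates act on the
  layers \<open>j\<close> with \<open>t < j\<close>; elsewhere both are the identity and the two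
  queries cancel. Layer \<open>j\<close> thus performs \<open>j\<close> walk steps without
  controlled queries. The last pair, closed by the mixer, is idle in every layer.\<close>

definition steps :: "nat \<Rightarrow> nat \<Rightarrow> (idx \<Rightarrow> idx \<Rightarrow> complex) \<Rightarrow> (idx \<Rightarrow> idx \<Rightarrow> complex)
    \<Rightarrow> nat \<Rightarrow> idx \<Rightarrow> idx \<Rightarrow> complex" where
  "steps H K B D n =
     (if n = 0 \<or> n = 2 * K then tens H (mixer K)
      else blk H (\<lambda>j. if (n - 1) div 2 < j then (if odd n then B else D) else involution id))"

definition walk :: "idx set \<Rightarrow> (idx \<Rightarrow> idx \<Rightarrow> complex) \<Rightarrow> (idx \<Rightarrow> idx \<Rightarrow> complex)
    \<Rightarrow> (idx \<Rightarrow> idx \<Rightarrow> complex) \<Rightarrow> (idx \<Rightarrow> complex) \<Rightarrow> (idx \<Rightarrow> complex)" where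
  "walk S B D Q \<psi> = apply_op S D (apply_op S (adj Q) (apply_op S B (apply_op S Q \<psi>)))"

lemma unitary_steps:
  assumes "is_unitary_on (basis N m h) B" "is_unitary_on (basis N m h) D"
  shows "is_unitary_on (basis N m (s + h)) (steps (2^h) (2^s) B D n)"
proof -
  have "is_unitary_on (basis N m (s + h)) (blk (2^h) (\<lambda>j. if (n - 1) div 2 < j then (if odd n then B else D) else involution id))"
    by (rule unitary_blk) (use assms in \<open>simp add: unitary_identity\<close>)
  moreover have "is_unitary_on (basis N m (s + h)) (tens (2^h) (mixer (2^s)))"
    by (rule unitary_tens, rule unitary_mixer) simp
  ultimately show ?thesis by (simp add: steps_def)
qed

lemma isometry_walk:
  assumes "finite S" "is_unitary_on S B" "is_unitary_on S D" "is_unitary_on S Q"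
  shows "linear_isometry S (walk S B D Q)"
proof -
  note I = unitary_isometry[OF assms(1)]
  note Q = assms(4)
  show ?thesis
    unfolding walk_def
    by (rule isometry_comp[OF I[OF assms(3)] isometry_comp[OF I[OF unitary_adj[OF assms(1) Q]]
          isometry_comp[OF I[OF assms(2)] I[OF Q]]]])
qed

text \<open>Between the two mixers neither gates nor queries change the counter, so each layer
  evolves on its own. The condition on \<open>n\<close> excludes the closing mixer.\<close>

lemma run_step:
  assumes n: "n + 1 \<noteq> 2 * 2^s"
    and j: "j < 2^s" and i: "i \<in> basis N m h"
  defines "S \<equiv> basis N m (s + h)" and "S0 \<equiv> basis N m h"
  shows "run S (steps (2^h) (2^s) B D) odd (lift_oracle Orc) (Suc n) (emb (2^h) j i)
    = apply_op S0 (if n div 2 < j then (if even n then B else D) else involution id)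
        (apply_op S0 (if odd n then adj (lift_oracle Orc) else lift_oracle Orc)
        (\<lambda>i. run S (steps (2^h) (2^s) B D) odd (lift_oracle Orc) n (emb (2^h) j i))) i"
proof -
  have *: "apply_op S (if odd n then adj (lift_oracle Orc) else lift_oracle Orc) \<Psi> (emb (2^h) j i)
     = apply_op S0 (if odd n then adj (lift_oracle Orc) else lift_oracle Orc) (\<lambda>i. \<Psi> (emb (2^h) j i)) i"
    if "i \<in> S0" for i \<Psi>
    using that j unfolding S_def S0_def by (simp add: apply_lift_oracle)
  have st: "steps (2^h) (2^s) B D (Suc n)
      = blk (2^h) (\<lambda>j. if n div 2 < j then (if even n then B else D) else involution id)"
    using n by (simp add: steps_def)
  show ?thesis
    unfolding run.simps st S_def apply_blk[OF j i] unfolding S_def[symmetric] S0_def[symmetric]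
    by (intro fun_cong[OF apply_op_cong] *)
qed

lemma apply_identity:
  "finite S \<Longrightarrow> i \<in> S \<Longrightarrow> apply_op S (involution id) \<psi> i = \<psi> i"
  by (simp add: apply_involution)

text \<open>A layer walks until the number of pairs reaches its counter value and then rests, hence
  \<open>min t j\<close>. The scalar factor comes from the opening mixer.\<close>

lemma run_even_layers:
  assumes Q: "is_unitary_on (basis N m h) (lift_oracle Orc)"
    and t: "t < 2^s" and j: "j < 2^s" and i: "i \<in> basis N m h"
  shows "run (basis N m (s + h)) (steps (2^h) (2^s) B D) odd (lift_oracle Orc) (2 * t) (emb (2^h) j i)
    = of_real (1 / sqrt (2^s)) * (walk (basis N m h) B D (lift_oracle Orc) ^^ (min t j)) start i"
  using t i
proof (induction t arbitrary: i)
  case 0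
  have z: "emb (2^h) j' i = (0, 0, 0) \<longleftrightarrow> j' = 0 \<and> i = (0, 0, 0)" for j'
    by (auto simp: emb_def split: prod.splits)
  have "run (basis N m (s + h)) (steps (2^h) (2^s) B D) odd (lift_oracle Orc) 0 (emb (2^h) j i)
    = (\<Sum>j'<2^s. mixer (2^s) j j' * (if emb (2^h) j' i = (0, 0, 0) then 1 else 0))"
    using j 0 by (simp add: steps_def apply_tens)
  also have "\<dots> = (\<Sum>j'<2^s. if j' = 0 then mixer (2^s) j j' * start i else 0)"
    by (intro sum.cong refl) (auto simp: z start_def)
  also have "\<dots> = of_real (1 / sqrt (2^s)) * start i"
    by (simp add: mixer_0)
  finally show ?case by simp
next
  case (Suc t)
  let ?S = "basis N m (s + h)" and ?L = "basis N m h" and ?Q = "lift_oracle Orc"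
  let ?W = "walk ?L B D ?Q" and ?R = "run ?S (steps (2^h) (2^s) B D) odd ?Q"
  let ?c = "complex_of_real (1 / sqrt (2^s))"
  have IH: "?R (2 * t) (emb (2^h) j i) = ?c * (?W ^^ (min t j)) start i" if "i \<in> ?L" for i
    using Suc that by simp
  have n: "2 * t + 1 \<noteq> 2 * 2^s" "Suc (2 * t) + 1 \<noteq> 2 * 2^s" 
    using Suc.prems(1) by linarith+
  let ?M = "\<lambda>U. if t < j then U else involution id"
  have 1: "?R (Suc (2 * t)) (emb (2^h) j i)
     = apply_op ?L (?M B) (apply_op ?L ?Q (\<lambda>i. ?c * (?W ^^ (min t j)) start i)) i"
    if "i \<in> ?L" for i
  proof -
    have "?R (Suc (2 * t)) (emb (2^h) j i)
        = apply_op ?L (?M B) (apply_op ?L ?Q (\<lambda>i. ?R (2 * t) (emb (2^h) j i))) i"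
      using run_step[OF n(1) j that, of B D] by (simp del: run.simps)
    also have "apply_op ?L ?Q (\<lambda>i. ?R (2 * t) (emb (2^h) j i))
        = apply_op ?L ?Q (\<lambda>i. ?c * (?W ^^ (min t j)) start i)"
      by (rule apply_op_cong[OF IH])
    finally show ?thesis .
  qed
  have "?R (Suc (Suc (2 * t))) (emb (2^h) j i)
      = apply_op ?L (?M D) (apply_op ?L (adj ?Q) (\<lambda>i. ?R (Suc (2 * t)) (emb (2^h) j i))) i"
    using run_step[OF n(2) j Suc.prems(2), of B D] by (simp del: run.simps)
  also have "apply_op ?L (adj ?Q) (\<lambda>i. ?R (Suc (2 * t)) (emb (2^h) j i))
      = apply_op ?L (adj ?Q)
          (apply_op ?L (?M B) (apply_op ?L ?Q (\<lambda>i. ?c * (?W ^^ (min t j)) start i)))"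
    by (rule apply_op_cong[OF 1])
  finally have "?R (Suc (Suc (2 * t))) (emb (2^h) j i) = apply_op ?L (?M D) (apply_op ?L (adj ?Q)
      (apply_op ?L (?M B) (apply_op ?L ?Q (\<lambda>i. ?c * (?W ^^ (min t j)) start i)))) i" .
  also have "\<dots> = ?c * (?W ^^ (min (Suc t) j)) start i"
  proof (cases "t < j")
    case True
    have lin: "apply_op ?L U (\<lambda>i. c * \<psi> i) = (\<lambda>i. c * apply_op ?L U \<psi> i)" for U \<psi> c
      by (auto simp: apply_op_def fun_eq_iff sum_distrib_left mult_ac)
    show ?thesis using True by (simp add: walk_def lin min_def del: of_real_divide)
  next
    case False
    \<comment> \<open>An idle layer: with the identity between them the query and its inverse
      cancel.\<close>
    have "apply_op ?L (adj ?Q) (apply_op ?L (involution id) (apply_op ?L ?Q \<psi>)) i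
        = apply_op ?L (adj ?Q) (apply_op ?L ?Q \<psi>) i" for \<psi>
      by (intro fun_cong[OF apply_op_cong]) (simp add: apply_identity)
    with False show ?thesis
      using Suc.prems(2) by (simp add: apply_identity apply_adj_cancel[OF finite_basis Q])
  qed
  finally show ?case by (simp del: run.simps)
qed

text \<open>The closing mixer contributes a second factor \<open>1 / sqrt K\<close>, with
  \<open>K\<close> the number of layers, so layer 0 holds exactly the orbit average.\<close>

lemma run_final_layer:
  assumes Q: "is_unitary_on (basis N m h) (lift_oracle Orc)"
    and i: "i \<in> basis N m h"
  shows "run (basis N m (s + h)) (steps (2^h) (2^s) B D) odd (lift_oracle Orc) (2 * 2^s) (emb (2^h) 0 i)
    = cesaro (walk (basis N m h) B D (lift_oracle Orc)) (2^s) start i"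
proof -
  let ?S = "basis N m (s + h)" and ?L = "basis N m h" and ?Q = "lift_oracle Orc"
  let ?W = "walk ?L B D ?Q" and ?R = "run ?S (steps (2^h) (2^s) B D) odd ?Q"
  let ?c = "complex_of_real (1 / sqrt (2^s))"
  \<comment> \<open>Isolates the last pair of queries: no counter value exceeds this
    \<open>t\<close>, so the pair is idle in all layers.\<close>
  obtain t :: nat where t: "2^s = Suc t" by (metis not0_implies_Suc power_not_zero zero_neq_numeral)
  have n: "2 * t + 1 \<noteq> 2 * 2^s" unfolding t by simp
  have layer: "apply_op ?S (adj ?Q) (?R (Suc (2 * t))) (emb (2^h) j i) = ?c * (?W ^^ j) start i"
    if j: "j < 2^s" for j
  proof -
    have tj: "\<not> t < j" "min t j = j" using j t by auto
    have 1: "?R (Suc (2 * t)) (emb (2^h) j i) = apply_op ?L ?Q (\<lambda>i. ?c * (?W ^^ j) start i) i"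
      if i: "i \<in> ?L" for i
    proof -
      have "?R (Suc (2 * t)) (emb (2^h) j i)
        = apply_op ?L ?Q (\<lambda>i. ?R (2 * t) (emb (2^h) j i)) i"
        using run_step[OF n j i, of B D] tj i by (simp add: apply_identity del: run.simps)
      also have "\<dots> = apply_op ?L ?Q (\<lambda>i. ?c * (?W ^^ j) start i) i"
        using run_even_layers[OF Q, of t s j] j t tj
        by (intro fun_cong[OF apply_op_cong]) simp
      finally show ?thesis .
    qed
    have "apply_op ?S (adj ?Q) (?R (Suc (2 * t))) (emb (2^h) j i)
        = apply_op ?L (adj ?Q) (\<lambda>i. ?R (Suc (2 * t)) (emb (2^h) j i)) i"
      by (rule apply_lift_oracle(2)[OF j i])
    also have "\<dots> = apply_op ?L (adj ?Q) (apply_op ?L ?Q (\<lambda>i. ?c * (?W ^^ j) start i)) i"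
      by (intro fun_cong[OF apply_op_cong] 1)
    also have "\<dots> = ?c * (?W ^^ j) start i"
      by (rule apply_adj_cancel[OF finite_basis Q i])
    finally show ?thesis .
  qed
  have e: "2 * 2^s = Suc (Suc (2 * t))" by (simp add: t)
  have "?R (2 * 2^s) (emb (2^h) 0 i)
      = apply_op ?S (tens (2^h) (mixer (2^s))) (apply_op ?S (adj ?Q) (?R (Suc (2 * t)))) (emb (2^h) 0 i)"
    unfolding e run.simps(2)[of ?S _ _ _ "Suc (2 * t)"] by (simp add: steps_def t)
  also have "\<dots> = (\<Sum>j<2^s. mixer (2^s) 0 j * (?c * (?W ^^ j) start i))"
    by (subst apply_tens) (use i layer in \<open>simp_all\<close>)
  also have "\<dots> = (?c * ?c) * (\<Sum>j<2^s. (?W ^^ j) start i)"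
    by (simp add: mixer_0 sum_distrib_left mult_ac)
  also have "?c * ?c = 1 / of_nat (2^s)"
    unfolding of_real_mult[symmetric] by simp
  finally show ?thesis by (simp add: cesaro_def)
qed

lemma nrm_run:
  assumes "N \<ge> 1" and U: "\<And>k. k \<le> t \<Longrightarrow> is_unitary_on (basis N m q) (Us k)"
    and Q: "is_unitary_on (basis N m q) Q"
  shows "nrm (basis N m q) (run (basis N m q) Us useinv Q t) = 1"
  using U
proof (induction t)
  case 0
  have "(nrm (basis N m q) (\<lambda>i. if i = (0, 0, 0) then 1 else 0))\<^sup>2 = 1"
    using zero_in_basis[OF assms(1)] by (simp add: nrm_sq if_distrib[of "\<lambda>x. (cmod x)\<^sup>2"] cong: if_cong)
  then have "nrm (basis N m q) (\<lambda>i. if i = (0, 0, 0) then 1 else 0) = 1"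
    by (metis nrm_nonneg one_power2 power2_eq_imp_eq zero_le_one)
  with 0 show ?case
    by (simp add: isometry_nrm[OF unitary_isometry])
next
  case (Suc t)
  have "is_unitary_on (basis N m q) (if useinv t then adj Q else Q)"
    using Q by (simp add: unitary_adj)
  with Suc show ?case
    by (simp add: isometry_nrm[OF unitary_isometry])
qed

lemma prob_output_interference:
  fixes s :: nat
  assumes Orc: "is_unitary_on ({0..<N} \<times> {0..<2^m}) Orc" and N: "N \<ge> 1"
    and BD: "is_unitary_on (basis N m h) B" "is_unitary_on (basis N m h) D"
  defines "p \<equiv> (nrm (basis N m h) (cesaro (walk (basis N m h) B D (lift_oracle Orc)) (2^s) start))\<^sup>2"
    and "P \<equiv> prob_output (basis N m (s + h))
        (run (basis N m (s + h)) (steps (2^h) (2^s) B D) odd (lift_oracle Orc) (2 * 2^s))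
        (\<lambda>i. layer (2^h) i \<noteq> 0)"
  shows "P False = p" "P True = 1 - p"
proof -
  let ?S = "basis N m (s + h)" 
  let ?R = "run ?S (steps (2^h) (2^s) B D) odd (lift_oracle Orc) (2 * 2^s)"
  have "P False = (\<Sum>i\<in>?S. if layer (2^h) i = 0 then (cmod (?R i))\<^sup>2 else 0)"
    unfolding P_def prob_output_def by (subst sum.inter_filter) (simp_all only: finite_basis not_not simp_thms)
  also have "\<dots> = (\<Sum>j<2^s. if j = 0 then \<Sum>i\<in>basis N m h. (cmod (?R (emb (2^h) j i)))\<^sup>2 else 0)"
    unfolding sum_layers by (intro sum.cong refl) (auto simp: layer_emb[where N = N and m = m])
  also have "\<dots> = p"
    unfolding p_def nrm_sq
    by (simp add: run_final_layer[OF unitary_lift_oracle[OF Orc]] del: run.simps cong: sum.cong)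
  finally show F: "P False = p" .
  have "P False + P True = (\<Sum>i\<in>?S. (cmod (?R i))\<^sup>2)"
    unfolding P_def prob_output_def
    by (subst sum.union_disjoint[symmetric]) (auto intro: sum.cong)
  also have "\<dots> = 1"
    unfolding nrm_sq[symmetric] nrm_run[OF N unitary_steps[OF BD] unitary_lift_oracle[OF Orc]] by simp
  finally show "P True = 1 - p" using F by simp
qed

section \<open>The walk on the line\<close>

text \<open>In the state \<open>(x, r, l)\<close> the value \<open>l = 0\<close> flags the start state (only
  \<open>(0, 0, 0)\<close> is ever reached), and \<open>l \<ge> 1\<close> stands for position \<open>l - 1\<close> on the line.\<close>

definition hop :: "nat \<Rightarrow> bool \<Rightarrow> nat \<Rightarrow> nat" where
  "hop H b l =
     (if b then (if l = 0 \<or> l = H - 1 then l else if odd l then l + 1 else l - 1)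
      else (if l < 2 then l else if even l then l + 1 else l - 1))"

definition shift :: "nat \<Rightarrow> idx \<Rightarrow> idx" where
  "shift H = (\<lambda>(x, r, l). (x, r, hop H (odd r) l))"

text \<open>The sign G of position \<open>l - 1\<close>, so even \<open>l\<close> are the odd
  positions. The second disjunct forces -1 at \<open>(x, 0, 1)\<close> too, so that the sign is -1
  on the support of \<open>pub\<close>, as \<open>unitary_reflection\<close> demands.\<close>

definition parity_sign :: "idx \<Rightarrow> real" where
  "parity_sign = (\<lambda>(x, r, l). if (even l \<longleftrightarrow> r = 0) \<or> (l = 1 \<and> r = 0) then - 1 else 1)"

text \<open>The vector chi; \<open>\<sigma>\<close> is the total weight of its uniform part. The
  inputs sit at line value 1, that is, position 0.\<close>

definition pub :: "nat \<Rightarrow> real \<Rightarrow> idx \<Rightarrow> real" where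
  "pub N \<sigma> = (\<lambda>(x, r, l). if r = 0 \<and> l = 1 then sqrt (\<sigma> / N)
      else if x = 0 \<and> r = 0 \<and> l = 0 then sqrt (1 - \<sigma>) else 0)"

text \<open>For even \<open>H\<close> the value \<open>H - 1\<close> is odd: it is the one point
  that the matching for answer 1 would pair with \<open>H\<close>, and it is kept fixed. The
  matching for answer 0 stays inside by itself.\<close>

lemma hop_less: "even H \<Longrightarrow> l < H \<Longrightarrow> hop H b l < H"
  unfolding hop_def by (cases b) (auto, presburger+)

lemma hop_hop: "even H \<Longrightarrow> l < H \<Longrightarrow> hop H b (hop H b l) = l"
  unfolding hop_def by (cases b) (auto, presburger+)

lemma unitary_shift: "is_unitary_on (basis N m (Suc g)) (involution (shift (2^Suc g)))"
  by (rule unitary_involution)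
     (auto simp: shift_def basis_def hop_less[of "2 * 2^g"] hop_hop[of "2 * 2^g"])

lemma sum_pub:
  assumes "N \<ge> 1" "g \<ge> 1"
  shows "(\<Sum>i\<in>basis N m g. of_real (pub N \<sigma> i) * F i)
     = of_real (sqrt (1 - \<sigma>)) * F (0, 0, 0) + of_real (sqrt (\<sigma> / N)) * (\<Sum>x<N. F (x, 0, 1) :: complex)"
proof -
  have g: "(2::nat) ^ g > 1" using assms by (intro one_less_power) auto
  define h where "h = (\<lambda>x (l :: nat). (if l = 0 then (if x = 0 then of_real (sqrt (1 - \<sigma>)) * F (0, 0, 0) else 0) else 0)
         + (if l = 1 then of_real (sqrt (\<sigma> / N)) * F (x, 0, 1) else 0))"
  have "of_real (pub N \<sigma> (x, r, l)) * F (x, r, l) = (if r = 0 then h x l else 0)" for x r l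
    by (auto simp: pub_def h_def)
  then have "(\<Sum>i\<in>basis N m g. of_real (pub N \<sigma> i) * F i)
     = (\<Sum>x<N. \<Sum>r<(2::nat)^m. \<Sum>l<2^g. if r = 0 then h x l else 0)"
    unfolding sum_basis by simp
  also have "\<dots> = (\<Sum>x<N. \<Sum>r<(2::nat)^m. if r = 0 then \<Sum>l<2^g. h x l else 0)"
    by (intro sum.cong refl) simp
  also have "\<dots> = (\<Sum>x<N. (if x = 0 then of_real (sqrt (1 - \<sigma>)) * F (0, 0, 0) else 0)
         + of_real (sqrt (\<sigma> / N)) * F (x, 0, 1))"
    using g by (simp add: h_def sum.distrib)
  also have "\<dots> = of_real (sqrt (1 - \<sigma>)) * F (0, 0, 0) + of_real (sqrt (\<sigma> / N)) * (\<Sum>x<N. F (x, 0, 1))"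
    using assms by (simp add: sum.distrib sum_distrib_left)
  finally show ?thesis .
qed

lemma pub_unit:
  assumes "N \<ge> 1" "g \<ge> 1" "0 \<le> \<sigma>" "\<sigma> \<le> 1"
  shows "(\<Sum>i\<in>basis N m g. (pub N \<sigma> i)\<^sup>2) = 1"
proof -
  have "complex_of_real (\<Sum>i\<in>basis N m g. (pub N \<sigma> i)\<^sup>2)
      = (\<Sum>i\<in>basis N m g. of_real (pub N \<sigma> i) * of_real (pub N \<sigma> i))"
    by (simp add: power2_eq_square)
  also have "\<dots> = of_real (sqrt (1 - \<sigma>) * sqrt (1 - \<sigma>) + N * (sqrt (\<sigma> / N) * sqrt (\<sigma> / N)))"
    unfolding sum_pub[OF assms(1,2)] by (simp add: pub_def mult_ac del: real_sqrt_mult_self)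
  also have "\<dots> = 1"
    using assms by simp
  finally show ?thesis by (simp only: of_real_eq_1_iff)
qed

lemma unitary_public_reflection:
  assumes "N \<ge> 1" "g \<ge> 1" "0 \<le> \<sigma>" "\<sigma> \<le> 1"
  shows "is_unitary_on (basis N m g) (reflection (pub N \<sigma>) parity_sign)"
  by (rule unitary_reflection[OF finite_basis pub_unit[OF assms]])
     (auto simp: parity_sign_def pub_def split: prod.splits if_splits dest: odd_pos)

lemma sum_odd_even_split:
  fixes F :: "nat \<Rightarrow> 'a :: comm_ring_1"
  shows "(\<Sum>r<n. c (odd r) * F r)
      = c False * (\<Sum>r | r < n \<and> odd r = False. F r) + c True * (\<Sum>r | r < n \<and> odd r = True. F r)"
proof -
  have eq: "{..<n} = {r. r < n \<and> odd r = False} \<union> {r. r < n \<and> odd r = True}" by auto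
  show ?thesis
    unfolding eq by (subst sum.union_disjoint) (auto simp: sum_distrib_left)
qed

section \<open>Columns of the oracle and their images under its inverse\<close>

locale biased =
  fixes N m :: nat and f :: "nat \<Rightarrow> bool" and \<epsilon> :: real
    and Orc :: "nat \<times> nat \<Rightarrow> nat \<times> nat \<Rightarrow> complex"
  assumes bo: "biased_oracle N m f \<epsilon> Orc"
    and N: "N \<ge> 1"
begin

abbreviation Q :: "idx \<Rightarrow> idx \<Rightarrow> complex" where "Q \<equiv> lift_oracle Orc"

text \<open>The probability of reading answer \<open>b\<close> after one query on \<open>x\<close>;
  the answer qubit is the lowest bit of \<open>r\<close>.\<close>

definition weight :: "bool \<Rightarrow> nat \<Rightarrow> real" where
  "weight b x = (\<Sum>r | r < 2^m \<and> odd r = b. (cmod (Orc (x, r) (x, 0)))\<^sup>2)"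

lemma m: "m \<ge> 1" and unitary_Orc: "is_unitary_on ({0..<N} \<times> {0..<2^m}) Orc"
  and off_diagonal: "x < N \<Longrightarrow> y < N \<Longrightarrow> r < 2^m \<Longrightarrow> y \<noteq> x \<Longrightarrow> Orc (y, r) (x, 0) = 0"
  using bo unfolding biased_oracle_def by blast+

lemma unitary_Q: "is_unitary_on (basis N m q) Q"
  by (rule unitary_lift_oracle[OF unitary_Orc])

lemma orth:
  assumes "x < N" "r < 2^m" "x' < N" "r' < 2^m"
  shows "(\<Sum>y<N. \<Sum>t<2^m. cnj (Orc (y, t) (x, r)) * Orc (y, t) (x', r'))
      = (if x = x' \<and> r = r' then 1 else 0)"
proof -
  have "(\<Sum>k\<in>{0..<N} \<times> {0..<2^m}. cnj (Orc k (x, r)) * Orc k (x', r'))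
      = (if (x, r) = (x', r') then 1 else 0)"
    using unitary_Orc assms unfolding is_unitary_on_def by auto
  then show ?thesis
    unfolding lessThan_atLeast0 sum.cartesian_product by (simp add: case_prod_unfold)
qed

text \<open>A column \<open>(x, r)\<close> may spread over several query values, but the column
  \<open>(y, 0)\<close> lives on \<open>y\<close> alone. Orthonormality therefore already holds on
  the slice \<open>y\<close>.\<close>

lemma orth_column:
  assumes "x < N" "r < 2^m" "y < N"
  shows "(\<Sum>t<2^m. cnj (Orc (y, t) (x, r)) * Orc (y, t) (y, 0)) = (if y = x \<and> r = 0 then 1 else 0)"
proof -
  have "(\<Sum>y'<N. \<Sum>t<2^m. cnj (Orc (y', t) (x, r)) * Orc (y', t) (y, 0))
     = (\<Sum>y'<N. if y' = y then \<Sum>t<2^m. cnj (Orc (y', t) (x, r)) * Orc (y', t) (y, 0) else 0)"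
    using assms off_diagonal by (intro sum.cong refl) (auto intro!: sum.neutral)
  then show ?thesis using orth[of x r y 0] assms by auto
qed

lemma weight_total:
  assumes "x < N"
  shows "weight False x + weight True x = 1"
proof -
  have "complex_of_real (\<Sum>t<2^m. (cmod (Orc (x, t) (x, 0)))\<^sup>2) = 1"
    using orth_column[of x 0 x] assms
    by (simp add: complex_norm_square mult.commute del: of_real_power)
  then have "(\<Sum>t<2^m. (cmod (Orc (x, t) (x, 0)))\<^sup>2) = 1"
    by (simp only: of_real_eq_1_iff)
  then show ?thesis
    using sum_odd_even_split[of "\<lambda>_. 1" "\<lambda>t. (cmod (Orc (x, t) (x, 0)))\<^sup>2" "2^m"]
    by (simp add: weight_def)
qed

lemma weight_nonneg: "weight b x \<ge> 0"
  by (simp add: weight_def sum_nonneg)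

lemma weight_correct:
  assumes x: "x < N"
  shows "weight (f x) x \<ge> 1/2 + \<epsilon>"
proof -
  obtain \<alpha> \<beta> wx wx' where n: "normalized_work m wx" and a: "(cmod \<alpha>)\<^sup>2 \<ge> 1/2 + \<epsilon>"
    and col: "\<And>w b. w < 2^(m-1) \<Longrightarrow> b < 2 \<Longrightarrow> Orc (x, 2*w + b) (x, 0) =
                \<alpha> * wx w * (if (b = 1) = f x then 1 else 0)
              + \<beta> * wx' w * (if (b = 1) = f x then 0 else 1)"
    using bo x unfolding biased_oracle_def by meson
  define b :: nat where "b = (if f x then 1 else 0)"
  have b: "b < 2" "(b = 1) = f x" by (auto simp: b_def)
  have m2: "(2::nat)^m = 2 * 2^(m-1)" using m by (metis Suc_diff_1 less_eq_Suc_le One_nat_def power_Suc)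
  \<comment> \<open>The work register enumerates the values of \<open>r\<close> with answer
    \<open>f x\<close>; there only the \<alpha> term survives.\<close>
  have bij: "bij_betw (\<lambda>w. 2 * w + b) {..<2^(m-1)} {r. r < 2^m \<and> odd r = f x}"
  proof (rule bij_betw_byWitness[where f' = "\<lambda>r. r div 2"])
    show "\<forall>a\<in>{..<2^(m-1)}. (2 * a + b) div 2 = a" using b by auto
    show "\<forall>a'\<in>{r. r < 2^m \<and> odd r = f x}. 2 * (a' div 2) + b = a'"
      by (auto simp: b_def)
    show "(\<lambda>w. 2 * w + b) ` {..<2^(m-1)} \<subseteq> {r. r < 2^m \<and> odd r = f x}"
      by (auto simp: b_def m2)
    show "(\<lambda>r. r div 2) ` {r :: nat. r < 2^m \<and> odd r = f x} \<subseteq> {..<2^(m-1)}"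
      by (auto simp: m2)
  qed
  have "weight (f x) x = (\<Sum>w<2^(m-1). (cmod (Orc (x, 2*w + b) (x, 0)))\<^sup>2)"
    unfolding weight_def by (rule sum.reindex_bij_betw[OF bij, symmetric])
  also have "\<dots> = (\<Sum>w<2^(m-1). (cmod \<alpha>)\<^sup>2 * (cmod (wx w))\<^sup>2)"
    using b by (intro sum.cong refl) (simp add: col norm_mult power_mult_distrib)
  also have "\<dots> = (cmod \<alpha>)\<^sup>2"
    using n by (simp add: normalized_work_def flip: sum_distrib_left)
  finally show ?thesis using a by simp
qed

text \<open>The images under the oracle of the states handled by the walk: both answer components of
  \<open>O|x,0\<rangle>\<close> are rescaled separately, by an amount that depends on the position on the line.\<close>

definition rescaled :: "(bool \<Rightarrow> nat \<Rightarrow> nat \<Rightarrow> real) \<Rightarrow> idx \<Rightarrow> complex" where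
  "rescaled c = (\<lambda>(x, r, l). of_real (c (odd r) x l) * Orc (x, r) (x, 0))"

lemma apply_adj_Q:
  assumes "(x, r, l) \<in> basis N m q"
  shows "apply_op (basis N m q) (adj Q) \<psi> (x, r, l)
     = (\<Sum>y<N. \<Sum>t<2^m. cnj (Orc (y, t) (x, r)) * \<psi> (y, t, l))"
proof -
  have l: "l < 2^q" using assms by (simp add: basis_def)
  have "apply_op (basis N m q) (adj Q) \<psi> (x, r, l)
    = (\<Sum>y<N. \<Sum>t<2^m. \<Sum>a<2^q. if a = l then cnj (Orc (y, t) (x, r)) * \<psi> (y, t, a) else 0)"
    using assms unfolding apply_op_def sum_basis
    by (simp only: if_True, intro sum.cong refl) (auto simp: adj_def lift_oracle_def)
  then show ?thesis using l by simp
qed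

text \<open>The component at \<open>r = 0\<close> is the inner product with the column
  \<open>(x, 0)\<close>, so the two scalings get averaged with the answer probabilities. Its
  vanishing is the recurrence along the line.\<close>

lemma adj_Q_rescaled_0:
  assumes "(x, 0, l) \<in> basis N m q"
  shows "apply_op (basis N m q) (adj Q) (rescaled c) (x, 0, l)
     = of_real (weight False x * c False x l + weight True x * c True x l)"
proof -
  have x: "x < N" using assms by (simp add: basis_def)
  have "apply_op (basis N m q) (adj Q) (rescaled c) (x, 0, l)
    = (\<Sum>y<N. if y = x then \<Sum>t<2^m. of_real (c (odd t) x l) * (cnj (Orc (x, t) (x, 0)) * Orc (x, t) (x, 0)) else 0)"
    unfolding apply_adj_Q[OF assms]
    using x off_diagonal by (intro sum.cong refl) (auto simp: rescaled_def mult_ac intro!: sum.neutral)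
  also have "\<dots> = of_real (\<Sum>t<2^m. c (odd t) x l * (cmod (Orc (x, t) (x, 0)))\<^sup>2)"
    using x by (simp add: complex_norm_square mult.commute del: of_real_power)
  also have "\<dots> = of_real (weight False x * c False x l + weight True x * c True x l)"
    using sum_odd_even_split[of "\<lambda>b. c b x l" "\<lambda>t. (cmod (Orc (x, t) (x, 0)))\<^sup>2" "2^m"]
    by (simp add: weight_def mult.commute)
  finally show ?thesis .
qed

text \<open>Equal scalings of both answers give a multiple of the full column \<open>(x, 0)\<close>,
  which the inverse oracle sends back to \<open>r = 0\<close>.\<close>

lemma adj_Q_rescaled_product:
  assumes i: "(x, r, l) \<in> basis N m q" and c: "\<And>y. c True y l = c False y l"
  shows "apply_op (basis N m q) (adj Q) (rescaled c) (x, r, l) = (if r = 0 then of_real (c False x l) else 0)"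
proof -
  have x: "x < N" "r < 2^m" using i by (simp_all add: basis_def)
  have c': "c (odd t) y l = c False y l" for t :: nat and y using c by (cases "odd t") auto
  have "apply_op (basis N m q) (adj Q) (rescaled c) (x, r, l)
     = (\<Sum>y<N. of_real (c False y l) * (\<Sum>t<2^m. cnj (Orc (y, t) (x, r)) * Orc (y, t) (y, 0)))"
    unfolding apply_adj_Q[OF i] rescaled_def by (simp add: c' sum_distrib_left mult_ac)
  also have "\<dots> = (\<Sum>y<N. if y = x then (if r = 0 then of_real (c False x l) else 0) else 0)"
    using x by (intro sum.cong refl) (simp add: orth_column)
  also have "\<dots> = (if r = 0 then of_real (c False x l) else 0)"
    using x by simp
  finally show ?thesis .
qed

text \<open>The two answer components are orthogonal with squared norms given by
  \<open>weight\<close>.\<close>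

lemma nrm_rescaled:
  "(nrm (basis N m q) (rescaled c))\<^sup>2
     = (\<Sum>x<N. \<Sum>l<2^q. weight False x * (c False x l)\<^sup>2 + weight True x * (c True x l)\<^sup>2)"
proof -
  have "(nrm (basis N m q) (rescaled c))\<^sup>2
    = (\<Sum>x<N. \<Sum>r<2^m. \<Sum>l<2^q. (c (odd r) x l)\<^sup>2 * (cmod (Orc (x, r) (x, 0)))\<^sup>2)"
    unfolding nrm_sq sum_basis by (simp add: rescaled_def norm_mult power_mult_distrib)
  also have "\<dots> = (\<Sum>x<N. \<Sum>l<2^q. \<Sum>r<2^m. (c (odd r) x l)\<^sup>2 * (cmod (Orc (x, r) (x, 0)))\<^sup>2)"
    by (intro sum.cong refl sum.swap)
  also have "\<dots> = (\<Sum>x<N. \<Sum>l<2^q. weight False x * (c False x l)\<^sup>2 + weight True x * (c True x l)\<^sup>2)"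
    unfolding weight_def
    using sum_odd_even_split[of "\<lambda>b. (c b _ _)\<^sup>2" "\<lambda>r. (cmod (Orc (_, r) (_, 0)))\<^sup>2" "2^m"]
    by (intro sum.cong refl) (simp only: mult.commute)
  finally show ?thesis .
qed

text \<open>The parameter \<open>g\<close> sets the line length. The weight
  \<open>\<epsilon> / 4\<close> in \<open>pub\<close> balances the two cases: small enough for
  catalysts of squared norm O(1/\<epsilon>) to leave the start state dominant, large enough to
  detect one marked input.\<close>

abbreviation W :: "nat \<Rightarrow> (idx \<Rightarrow> complex) \<Rightarrow> (idx \<Rightarrow> complex)" where
  "W g \<equiv> walk (basis N m (Suc g)) (involution (shift (2^Suc g)))
     (reflection (pub N (\<epsilon> / 4)) parity_sign) Q"

text \<open>The oracle cancels its inverse, and the oracle entry in \<open>rescaled\<close> does not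
  depend on \<open>l\<close>, so \<open>shift\<close> acts on the scaling alone. The walk is thereby
  reduced to real amplitudes on the line.\<close>

lemma walk_rescaled:
  fixes c :: "bool \<Rightarrow> nat \<Rightarrow> nat \<Rightarrow> real" and g :: nat
  defines "S \<equiv> basis N m (Suc g)"
  shows "W g (apply_op S (adj Q) (rescaled c)) =
    apply_op S (reflection (pub N (\<epsilon> / 4)) parity_sign)
      (apply_op S (adj Q) (rescaled (\<lambda>b x l. c b x (hop (2^Suc g) b l))))"
proof -
  have 1: "apply_op S (involution (shift (2^Suc g))) (apply_op S Q (apply_op S (adj Q) (rescaled c)))
     = apply_op S (involution (shift (2^Suc g))) (rescaled c)"
    by (rule apply_op_cong) (simp add: S_def apply_op_adj_cancel[OF finite_basis unitary_Q])
  have 2: "apply_op S (involution (shift (2^Suc g))) (rescaled c) i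
     = rescaled (\<lambda>b x l. c b x (hop (2^Suc g) b l)) i" if "i \<in> S" for i
  proof -
    have "shift (2^Suc g) i \<in> S"
      using that by (auto simp: S_def shift_def basis_def hop_less[of "2 * 2^g"])
    then show ?thesis
      using that by (auto simp: S_def apply_involution rescaled_def shift_def split: prod.splits)
  qed
  show ?thesis
    unfolding walk_def S_def[symmetric] 1
    by (rule arg_cong[where f = "apply_op S (reflection _ _)"], rule apply_op_cong, rule 2)
qed

end

section \<open>Decaying amplitudes and the pairs exchanged by \<open>hop\<close>\<close>

lemma geometric_sum_le:
  fixes \<rho> :: real
  assumes "0 \<le> \<rho>" "\<rho> < 1"
  shows "(\<Sum>l<n. \<rho> ^ l) \<le> 1 / (1 - \<rho>)"
proof -
  have "(\<Sum>l<n. \<rho> ^ l) = (1 - \<rho> ^ n) / (1 - \<rho>)"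
    using assms by (simp add: sum_gp_strict)
  also have "\<dots> \<le> 1 / (1 - \<rho>)"
    using assms by (intro divide_right_mono) auto
  finally show ?thesis .
qed

text \<open>For odd \<open>n\<close> the exponents differ by one, and \<open>v - u * \<rho>\<close>
  factors out. This makes the \<open>r = 0\<close> component vanish.\<close>

lemma neg_power_half_cancel:
  fixes u v \<rho> :: real
  assumes "u * \<rho> = v" "odd n"
  shows "u * (- \<rho>) ^ (Suc n div 2) + v * (- \<rho>) ^ (n div 2) = 0"
proof -
  obtain k where "n = 2 * k + 1" using \<open>odd n\<close> oddE by blast
  then show ?thesis using assms(1) by (simp add: algebra_simps)
qed

text \<open>For odd \<open>n\<close> the bracket \<open>u * \<rho>^2 + v\<close> equals
  \<open>\<rho> * (u + v)\<close>, so squared norms along the line form a geometric series.\<close>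

lemma neg_power_half_weight:
  fixes u v \<rho> :: real
  assumes "u * \<rho> = v" "u + v = 1"
  shows "u * ((- \<rho>) ^ (Suc n div 2))\<^sup>2 + v * ((- \<rho>) ^ (n div 2))\<^sup>2 = \<rho> ^ n"
proof (cases "even n")
  case True
  then obtain k where k: "n = 2 * k" by blast
  have "((- \<rho>) ^ k)\<^sup>2 = \<rho> ^ n"
    by (simp add: k flip: power_mult_distrib power_mult) (simp add: power_mult mult.commute[of k])
  then show ?thesis using assms(2) by (simp add: k flip: distrib_right)
next
  case False
  then obtain k where k: "n = 2 * k + 1" using oddE by blast
  have *: "((- \<rho>) ^ k)\<^sup>2 = \<rho> ^ (2 * k)"
    by (simp add: power_mult[symmetric] mult.commute[of k]) 
  have "u * ((- \<rho>) ^ Suc k)\<^sup>2 + v * ((- \<rho>) ^ k)\<^sup>2 = (u * \<rho> * \<rho> + v) * \<rho> ^ (2 * k)"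
    using * by (simp add: power_mult_distrib power2_eq_square algebra_simps)
  also have "u * \<rho> * \<rho> + v = \<rho> * (u + v)"
    using assms(1) by (simp add: algebra_simps)
  finally show ?thesis using assms(2) by (simp add: k)
qed

lemma hop_eq_0_iff: "even H \<Longrightarrow> l < H \<Longrightarrow> hop H b l = 0 \<longleftrightarrow> l = 0"
  unfolding hop_def by (cases b) auto

text \<open>These quotients number the exchanged pairs, so amplitudes depending only on them are
  invariant under \<open>hop\<close>.\<close>

lemma hop_half:
  assumes "l \<noteq> 0"
  shows "(hop H True l - 1) div 2 = (l - 1) div 2" "hop H False l div 2 = l div 2"
    "l \<ge> 2 \<Longrightarrow> (hop H False l - 2) div 2 = (l - 2) div 2"
  unfolding hop_def using assms by ((auto elim!: evenE oddE; presburger)+)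

text \<open>Away from its fixed points \<open>hop\<close> changes parity, which flips a sign
  alternating along the line.\<close>

lemma hop_parity:
  assumes "l \<noteq> 0" "\<not> (b \<and> l = H - 1)" "\<not> (\<not> b \<and> l = 1)"
  shows "even (hop H b l) \<longleftrightarrow> odd l" "\<not> b \<Longrightarrow> hop H b l \<ge> 2" "hop H b l \<noteq> 0"
  unfolding hop_def using assms by (cases b; auto; presburger)+

section \<open>The orbit average without and with a marked input\<close>

context biased
begin

lemma isometry_W:
  assumes "0 < \<epsilon>" "\<epsilon> \<le> 1/2"
  shows "linear_isometry (basis N m (Suc g)) (W g)"
  by (intro isometry_walk finite_basis unitary_shift unitary_public_reflection unitary_Q)
     (use N assms in auto)

text \<open>With no marked input, chi plus its catalysts is an exactly fixed vector, for every line
  length, with large overlap with \<open>start\<close>.\<close>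

lemma cesaro_lower_bound:
  assumes f: "\<And>x. x < N \<Longrightarrow> \<not> f x" and \<epsilon>: "0 < \<epsilon>" "\<epsilon> \<le> 1/2" and K: "K > 0"
  shows "2/3 \<le> (nrm (basis N m (Suc g)) (cesaro (W g) K start))\<^sup>2"
proof -
  define S where "S = basis N m (Suc g)"
  define H :: nat where "H = 2 ^ Suc g"
  define \<sigma> where "\<sigma> = \<epsilon> / 4"
  define \<rho> where "\<rho> x = weight True x / weight False x" for x
  \<comment> \<open>Constant on the pairs exchanged by \<open>hop\<close>; at \<open>l = 1\<close>
    both exponents are 0, which reproduces \<open>pub\<close>.\<close>
  define c :: "bool \<Rightarrow> nat \<Rightarrow> nat \<Rightarrow> real" where
    "c b x l = (if l = 0 then (if x = 0 then sqrt (1 - \<sigma>) else 0)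
       else sqrt (\<sigma> / N) * (- \<rho> x) ^ (if b then (l - 1) div 2 else l div 2))" for b x l
  define \<phi> where "\<phi> = apply_op S (adj Q) (rescaled c)"
  have \<sigma>: "0 < \<sigma>" "\<sigma> \<le> 1/8" using \<epsilon> by (auto simp: \<sigma>_def)
  have H: "even H" "H > 0" by (auto simp: H_def)
  have w: "weight False x \<ge> 1/2 + \<epsilon>" "weight False x + weight True x = 1" if "x < N" for x
    using weight_correct[OF that] weight_total[OF that] f[OF that] by auto
  have \<rho>: "weight False x * \<rho> x = weight True x" "0 \<le> \<rho> x" "\<rho> x \<le> 1 - 2 * \<epsilon>" if x: "x < N" for x
  proof -
    have p: "weight False x > 0" using w(1)[OF x] \<epsilon> by linarith
    then show "weight False x * \<rho> x = weight True x" by (simp add: \<rho>_def)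
    show "0 \<le> \<rho> x" by (simp add: \<rho>_def weight_nonneg)
    have le1: "weight False x \<le> 1" using w(2)[OF x] weight_nonneg[of True x] by linarith
    have "weight True x \<le> weight False x - 2 * \<epsilon>" using w[OF x] by linarith
    also have "\<dots> \<le> weight False x - 2 * \<epsilon> * weight False x"
      using mult_left_mono[OF le1, of "2 * \<epsilon>"] \<epsilon> by simp
    finally show "\<rho> x \<le> 1 - 2 * \<epsilon>"
      using p by (simp add: \<rho>_def field_simps)
  qed
  have \<phi>_0: "\<phi> (x, 0, l) = of_real (weight False x * c False x l + weight True x * c True x l)"
    if "(x, 0, l) \<in> S" for x l
    using that unfolding \<phi>_def S_def by (rule adj_Q_rescaled_0)
  have \<phi>_product: "\<phi> (x, r, l) = (if r = 0 then of_real (c False x l) else 0)"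
    if "(x, r, l) \<in> S" "l = 0 \<or> odd l" for x r l
    using that unfolding \<phi>_def S_def
    by (intro adj_Q_rescaled_product) (auto simp: c_def elim!: oddE)
  have \<phi>_pub: "pub N \<sigma> i \<noteq> 0 \<Longrightarrow> \<phi> i = of_real (pub N \<sigma> i)" if "i \<in> S" for i
    using that \<phi>_product[of "fst i" "fst (snd i)" "snd (snd i)"]
    by (auto simp: pub_def c_def split: prod.splits if_splits)
  have "apply_op S (reflection (pub N \<sigma>) parity_sign) \<phi> i = \<phi> i" if i: "i \<in> S" for i
  proof -
    have "(\<Sum>j\<in>S. of_real (pub N \<sigma> j) * \<phi> j) = (\<Sum>j\<in>S. of_real ((pub N \<sigma> j)\<^sup>2))"
      using \<phi>_pub by (intro sum.cong refl) (auto simp: power2_eq_square)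
    also have "\<dots> = of_real (\<Sum>j\<in>S. (pub N \<sigma> j)\<^sup>2)" by simp
    also have "\<dots> = 1"
      unfolding S_def using pub_unit[OF N, of "Suc g" \<sigma> m] \<sigma> by simp
    finally have "apply_op S (reflection (pub N \<sigma>) parity_sign) \<phi> i
        = 2 * of_real (pub N \<sigma> i) + of_real (parity_sign i) * \<phi> i"
      using i by (simp add: apply_reflection S_def)
    also have "\<dots> = \<phi> i"
    proof (cases "pub N \<sigma> i = 0")
      case False
      then have "parity_sign i = - 1"
        by (auto simp: parity_sign_def pub_def split: prod.splits if_splits dest: odd_pos)
      then show ?thesis using \<phi>_pub[OF i False] by simp
    next
      case True
      obtain x r l where xrl: "i = (x, r, l)" by (metis prod_cases3)
      have x: "x < N" using i by (simp add: xrl S_def basis_def)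
      have sig: "\<sigma> / N \<noteq> 0" using \<sigma> N by simp
      \<comment> \<open>At odd \<open>l\<close> the scalings agree, so only \<open>r = 0\<close>
        occurs, with sign +1 beyond \<open>l = 1\<close>. At even \<open>l\<close> the recurrence
        kills \<open>r = 0\<close>, and the rest has sign +1.\<close>
      have "\<phi> i = 0 \<or> parity_sign i = 1"
      proof (cases "l = 0 \<or> odd l")
        case odd: True
        show ?thesis
          using \<phi>_product[of x r l] i odd True sig \<sigma>
          by (auto simp: xrl parity_sign_def pub_def c_def split: if_splits)
      next
        case even: False
        then obtain n where n: "l = Suc n" "odd n" by (cases l) auto
        show ?thesis
        proof (cases "r = 0")
          case r: True
          have "weight False x * c False x l + weight True x * c True x l = sqrt (\<sigma> / N) *
             (weight False x * (- \<rho> x) ^ (Suc n div 2) + weight True x * (- \<rho> x) ^ (n div 2))"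
            by (simp add: c_def n algebra_simps del: div_Suc)
          also have "\<dots> = 0"
            using neg_power_half_cancel[OF \<rho>(1)[OF x] n(2)] by simp
          finally show ?thesis using \<phi>_0[of x l] i by (simp add: xrl r)
        next
          case False
          then show ?thesis using even by (auto simp: xrl parity_sign_def)
        qed
      qed
      with True show ?thesis by auto
    qed
    finally show ?thesis .
  qed
  \<comment> \<open>The fixed-point equation is one of functions, so the points outside
    \<open>S\<close> are compared too.\<close>
  moreover have "\<phi> i = 0" "apply_op S U \<psi> i = 0" if "i \<notin> S" for i U \<psi>
    using that by (auto simp: \<phi>_def apply_op_def)
  ultimately have reflected: "apply_op S (reflection (pub N \<sigma>) parity_sign) \<phi> = \<phi>"
    by (metis ext)
  \<comment> \<open>The cut-off costs nothing here: the far end is a fixed point of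
    \<open>hop\<close>, and an invariant amplitude stays invariant.\<close>
  have "rescaled (\<lambda>b x l. c b x (hop H b l)) i = rescaled c i" if "i \<in> S" for i
  proof -
    obtain x r l where xrl: "i = (x, r, l)" by (metis prod_cases3)
    have l: "l < H" using that by (simp add: xrl S_def basis_def H_def)
    have "c b x (hop H b l) = c b x l" for b
      using hop_eq_0_iff[OF H(1) l, of b] hop_half(1,2)[of l H]
      by (cases b) (auto simp: c_def)
    then show ?thesis by (simp add: xrl rescaled_def)
  qed
  then have fixed: "W g \<phi> = \<phi>"
    unfolding \<phi>_def S_def walk_rescaled
    using reflected unfolding \<phi>_def S_def \<sigma>_def H_def
    by (metis (no_types, lifting) apply_op_cong)
  have "(nrm S \<phi>)\<^sup>2 = (nrm S (rescaled c))\<^sup>2"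
    unfolding \<phi>_def S_def
    by (simp add: isometry_nrm[OF unitary_isometry[OF finite_basis unitary_adj[OF finite_basis unitary_Q]]])
  also have "\<dots> = (\<Sum>x<N. \<Sum>l<H. weight False x * (c False x l)\<^sup>2 + weight True x * (c True x l)\<^sup>2)"
    unfolding S_def H_def by (rule nrm_rescaled)
  also have "\<dots> \<le> (\<Sum>x<N. (if x = 0 then 1 - \<sigma> else 0) + (\<sigma> / N) * (1 / (2 * \<epsilon>)))"
  proof (rule sum_mono)
    fix x assume "x \<in> {..<N}"
    then have x: "x < N" by simp
    obtain n where n: "H = Suc n" using H by (cases H) auto
    have "(\<Sum>l<H. weight False x * (c False x l)\<^sup>2 + weight True x * (c True x l)\<^sup>2)
      = (weight False x + weight True x) * (c True x 0)\<^sup>2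
        + (\<Sum>l<n. weight False x * (c False x (Suc l))\<^sup>2 + weight True x * (c True x (Suc l))\<^sup>2)"
      unfolding n sum.lessThan_Suc_shift by (simp add: c_def algebra_simps)
    also have "\<dots> = (if x = 0 then 1 - \<sigma> else 0) + (\<Sum>l<n. (\<sigma> / N) * \<rho> x ^ l)"
    proof -
      have "weight False x * (c False x (Suc l))\<^sup>2 + weight True x * (c True x (Suc l))\<^sup>2
         = (\<sigma> / N) * \<rho> x ^ l" for l
      proof -
        have "weight False x * (c False x (Suc l))\<^sup>2 + weight True x * (c True x (Suc l))\<^sup>2
          = (sqrt (\<sigma> / N))\<^sup>2 * (weight False x * ((- \<rho> x) ^ (Suc l div 2))\<^sup>2 + weight True x * ((- \<rho> x) ^ (l div 2))\<^sup>2)"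
          by (simp add: c_def power_mult_distrib algebra_simps del: real_sqrt_pow2 real_sqrt_pow2_iff div_Suc)
        then show ?thesis
          using \<sigma> by (simp add: neg_power_half_weight[OF \<rho>(1) w(2)] x)
      qed
      then show ?thesis using \<sigma> w(2)[OF x] by (simp add: c_def)
    qed
    also have "(\<Sum>l<n. (\<sigma> / N) * \<rho> x ^ l) = (\<sigma> / N) * (\<Sum>l<n. \<rho> x ^ l)"
      by (rule sum_distrib_left[symmetric])
    also have "\<dots> \<le> (\<sigma> / N) * (1 / (2 * \<epsilon>))"
    proof (rule mult_left_mono)
      have "(\<Sum>l<n. \<rho> x ^ l) \<le> 1 / (1 - \<rho> x)"
        using \<rho>[OF x] \<epsilon> by (intro geometric_sum_le) auto
      also have "\<dots> \<le> 1 / (2 * \<epsilon>)"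
        using \<rho>[OF x] \<epsilon> by (intro divide_left_mono) auto
      finally show "(\<Sum>l<n. \<rho> x ^ l) \<le> 1 / (2 * \<epsilon>)" .
    qed (use \<sigma> in auto)
    finally show "(\<Sum>l<H. weight False x * (c False x l)\<^sup>2 + weight True x * (c True x l)\<^sup>2)
       \<le> (if x = 0 then 1 - \<sigma> else 0) + (\<sigma> / N) * (1 / (2 * \<epsilon>))" by simp
  qed
  \<comment> \<open>The \<open>N\<close> lines together weigh at most
    \<open>\<sigma> / (2 * \<epsilon>)\<close>, which is 1/8.\<close>
  also have "\<dots> = 1 - \<sigma> + 1/8"
    using N \<epsilon> by (simp add: sum.distrib \<sigma>_def)
  also have "\<dots> \<le> 9/8" using \<sigma> by simp
  finally have norm: "(nrm S \<phi>)\<^sup>2 \<le> 9/8" .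
  have z: "(0, 0, 0) \<in> S" using N by (simp add: S_def)
  have "ip S \<phi> start = (\<Sum>i\<in>S. if i = (0, 0, 0) then cnj (\<phi> i) else 0)"
    unfolding ip_def by (intro sum.cong refl) (auto simp: start_def)
  also have "\<dots> = of_real (sqrt (1 - \<sigma>))"
    using z \<phi>_product[OF z] by (simp add: S_def c_def)
  finally have "(cmod (ip S \<phi> start))\<^sup>2 = 1 - \<sigma>" using \<sigma> by simp
  moreover have "(cmod (ip S \<phi> start))\<^sup>2 \<le> (nrm S \<phi>)\<^sup>2 * (nrm S (cesaro (W g) K start))\<^sup>2"
    unfolding S_def
    by (rule cesaro_fixed_lower_bound[where W = "W g", OF isometry_W[OF \<epsilon>] fixed K])
  moreover have "(nrm S \<phi>)\<^sup>2 * (nrm S (cesaro (W g) K start))\<^sup>2 \<le> 9/8 * (nrm S (cesaro (W g) K start))\<^sup>2"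
    using norm by (rule mult_right_mono) simp
  \<comment> \<open>The quotient 7/9 exceeds 2/3.\<close>
  ultimately have "7/8 \<le> 9/8 * (nrm S (cesaro (W g) K start))\<^sup>2" using \<sigma> by linarith
  then show ?thesis by (simp add: S_def)
qed

text \<open>One marked input suffices to write \<open>start\<close> as
  \<open>W \<phi> - \<phi>\<close> plus a small defect: apart from the start state the scaling
  \<open>c\<close> lives on \<open>x0\<close> only. The bound on \<open>K\<close> makes the
  telescoped term at most 1/2, the one on \<open>g\<close> the defect at most 1/20.\<close>

lemma cesaro_upper_bound:
  assumes f: "x0 < N" "f x0" and \<epsilon>: "0 < \<epsilon>" "\<epsilon> \<le> 1/2"
    and K: "6 * sqrt N / \<epsilon> \<le> real K"
    and g: "8 * (N / \<epsilon>) * ((1 - 2 * \<epsilon>) ^ (2^g - 1))\<^sup>2 \<le> 1/400"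
  shows "(nrm (basis N m (Suc g)) (cesaro (W g) K start))\<^sup>2 \<le> 1/3"
proof -
  define S where "S = basis N m (Suc g)"
  define H :: nat where "H = 2 ^ Suc g"
  define \<sigma> where "\<sigma> = \<epsilon> / 4"
  define u where "u = weight True x0"
  define v where "v = weight False x0"
  define \<rho> where "\<rho> = v / u"
  \<comment> \<open>Chosen to make \<open>\<phi> + start\<close>, with amplitude 1/2 at the start
    state and \<open>a\<close> at \<open>x0\<close>, orthogonal to \<open>pub\<close>.\<close>
  define a where "a = - sqrt (1 - \<sigma>) / (2 * sqrt (\<sigma> / N))"
  \<comment> \<open>The alternating sign makes \<open>hop\<close> negate \<open>d\<close>. As
    \<open>hop\<close> fixes \<open>l = 1\<close> for answer 0, the amplitude there must be 0.
    Compared with the unmarked case the exponents are shifted: the scalings agree at even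
    \<open>l\<close>, and the recurrence holds at odd \<open>l\<close> from 3 on.\<close>
  define d where "d b l = (- 1) ^ (l - 1) * (if b then (- \<rho>) ^ ((l - 1) div 2)
      else if l = 1 then 0 else (- \<rho>) ^ ((l - 2) div 2))" for b and l :: nat
  define c :: "bool \<Rightarrow> nat \<Rightarrow> nat \<Rightarrow> real" where
    "c b x l = (if l = 0 then (if x = 0 then - 1/2 else 0) else if x = x0 then a / u * d b l else 0)" for b x l
  \<comment> \<open>Negation fails by twice the amplitude at points that \<open>hop\<close> fixes:
    \<open>e\<close> records this at the far end and \<open>z\<close> at \<open>l = 0\<close>. The
    image of \<open>z\<close> is \<open>- start\<close>.\<close>
  define e :: "bool \<Rightarrow> nat \<Rightarrow> nat \<Rightarrow> real" where
    "e b x l = (if b \<and> l = H - 1 then 2 * c b x l else 0)" for b x l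
  define z :: "bool \<Rightarrow> nat \<Rightarrow> nat \<Rightarrow> real" where
    "z b x l = (if l = 0 then 2 * c b x l else 0)" for b x l
  define R where "R = reflection (pub N \<sigma>) parity_sign"
  define A where "A = apply_op S (adj Q)"
  define \<phi> where "\<phi> = A (rescaled c)"
  define \<eta> where "\<eta> = A (rescaled e)"
  have \<sigma>: "0 < \<sigma>" "\<sigma> \<le> 1/8" using \<epsilon> by (auto simp: \<sigma>_def)
  have H: "even H" "H > 0" by (auto simp: H_def)
  have w: "u \<ge> 1/2 + \<epsilon>" "u + v = 1" "v \<ge> 0"
    using weight_correct[OF f(1)] weight_total[OF f(1)] f(2) weight_nonneg[of False x0]
    by (auto simp: u_def v_def)
  then have u: "u \<ge> 1/2" "u > 0" "u \<le> 1" using \<epsilon> by auto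
  have \<rho>: "u * \<rho> = v" "0 \<le> \<rho>" "\<rho> \<le> 1 - 2 * \<epsilon>"
  proof -
    show "u * \<rho> = v" "0 \<le> \<rho>" using u w by (simp_all add: \<rho>_def)
    have "v \<le> u - 2 * \<epsilon>" using w by linarith
    also have "\<dots> \<le> u - 2 * \<epsilon> * u"
      using mult_left_mono[OF u(3), of "2 * \<epsilon>"] \<epsilon> by simp
    finally show "\<rho> \<le> 1 - 2 * \<epsilon>" using u by (simp add: \<rho>_def field_simps)
  qed
  have z0: "(0, 0, 0) \<in> S" using N by (simp add: S_def)
  have A_iso: "linear_isometry S A"
    unfolding A_def S_def
    by (rule unitary_isometry[OF finite_basis unitary_adj[OF finite_basis unitary_Q]])
  have R_iso: "linear_isometry S (apply_op S R)"
    unfolding R_def S_def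
    by (rule unitary_isometry[OF finite_basis unitary_public_reflection]) (use N \<sigma> in auto)
  have A_outside: "A \<psi> i = 0" if "i \<notin> S" for i \<psi> using that by (simp add: A_def apply_op_def)
  have \<phi>_0: "\<phi> (x, 0, l) = of_real (weight False x * c False x l + weight True x * c True x l)"
    if "(x, 0, l) \<in> S" for x l
    using that unfolding \<phi>_def S_def A_def by (rule adj_Q_rescaled_0)
  have d_even: "d True l = d False l" if "even l" "0 < l" for l
  proof -
    have "(l - 1) div 2 = (l - 2) div 2" "l \<noteq> 1" using that by presburger+
    then show ?thesis by (simp add: d_def)
  qed
  have \<phi>_product: "\<phi> (x, r, l) = (if r = 0 then of_real (c False x l) else 0)"
    if "(x, r, l) \<in> S" "even l" for x r l
    using that unfolding \<phi>_def S_def A_def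
    by (intro adj_Q_rescaled_product) (simp_all add: c_def d_even)
  have \<phi>_1: "\<phi> (x, 0, 1) = (if x = x0 then of_real a else 0)" if "x < N" for x
  proof -
    have "(1::nat) < 2 ^ Suc g" by (rule one_less_power) auto
    then have "(x, 0, 1) \<in> S" using that by (simp add: S_def basis_def)
    from \<phi>_0[OF this] show ?thesis using u by (simp add: c_def d_def u_def)
  qed
  have start_image: "A (rescaled z) = (\<lambda>i. - start i)"
  proof
    fix i :: idx
    obtain x r l where xrl: "i = (x, r, l)" by (metis prod_cases3)
    show "A (rescaled z) i = - start i"
    proof (cases "i \<in> S")
      case True
      then show ?thesis
        using adj_Q_rescaled_product[of x r l "Suc g" z]
        by (auto simp: xrl A_def S_def z_def c_def start_def)
    next
      case False
      then show ?thesis using A_outside z0 by (auto simp: start_def)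
    qed
  qed
  have hop_image: "A (rescaled (\<lambda>b x l. c b x (hop H b l))) = (\<lambda>i. \<eta> i - (\<phi> i + start i))"
  proof -
    have "rescaled (\<lambda>b x l. c b x (hop H b l)) i
        = (rescaled e i + rescaled z i) - rescaled c i" if "i \<in> S" for i
    proof -
      obtain x r l where xrl: "i = (x, r, l)" by (metis prod_cases3)
      have l: "l < H" using that by (simp add: xrl S_def basis_def H_def)
      have "c b x (hop H b l) = e b x l + z b x l - c b x l" for b
      proof (cases "l = 0")
        case True
        have "H \<noteq> 1" using H by auto
        then have "0 \<noteq> H - 1" using H by auto
        with True show ?thesis
          using hop_eq_0_iff[OF H(1) l, of b] by (simp add: e_def z_def c_def)
      next
        case l0: False
        show ?thesis
        proof (cases "b \<and> l = H - 1 \<or> \<not> b \<and> l = 1")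
          case True
          then have "hop H b l = l" using l0 by (auto simp: hop_def)
          with True l0 show ?thesis by (auto simp: e_def z_def c_def d_def)
        next
          case False
          then have h: "even (hop H b l) \<longleftrightarrow> odd l" "\<not> b \<Longrightarrow> hop H b l \<ge> 2" "hop H b l \<noteq> 0"
            using hop_parity[OF l0, of b H] by auto
          have sign: "(- 1 :: real) ^ (hop H b l - 1) = - ((- 1) ^ (l - 1))"
            using h(1,3) l0 by (cases "hop H b l"; cases l) (auto simp: minus_one_power_iff)
          have "d b (hop H b l) = - d b l"
            using False h l0 hop_half[of l H] sign by (cases b) (auto simp: d_def)
          then show ?thesis
            using False h(3) l0 by (auto simp: c_def e_def z_def)
        qed
      qed
      then show ?thesis by (simp add: xrl rescaled_def left_diff_distrib distrib_right)
    qed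
    then have "A (rescaled (\<lambda>b x l. c b x (hop H b l)))
        = A (\<lambda>i. (rescaled e i + rescaled z i) - rescaled c i)"
      unfolding A_def by (intro apply_op_cong) auto
    also have "\<dots> = (\<lambda>i. \<eta> i - (\<phi> i + start i))"
      unfolding isometry_diff[OF A_iso] isometry_add[OF A_iso] start_image \<eta>_def \<phi>_def
      by (simp add: fun_eq_iff)
    finally show ?thesis .
  qed
  \<comment> \<open>Besides being orthogonal to \<open>pub\<close>, the vector vanishes wherever the
    sign is +1.\<close>
  have reflected: "apply_op S R (\<lambda>i. \<phi> i + start i) = (\<lambda>i. - (\<phi> i + start i))"
  proof
    fix i :: idx
    obtain x r l where xrl: "i = (x, r, l)" by (metis prod_cases3)
    show "apply_op S R (\<lambda>i. \<phi> i + start i) i = - (\<phi> i + start i)"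
    proof (cases "i \<in> S")
      case i: True
      then have x: "x < N" by (simp add: xrl S_def basis_def)
      have "sqrt (\<sigma> / N) * a = - sqrt (1 - \<sigma>) / 2"
        using \<sigma> N by (simp add: a_def)
      moreover have "(\<Sum>j\<in>S. of_real (pub N \<sigma> j) * (\<phi> j + start j))
         = of_real (sqrt (1 - \<sigma>) * (1/2) + sqrt (\<sigma> / N) * a)"
      proof -
        have "(\<Sum>x<N. \<phi> (x, 0, 1) + start (x, 0, 1)) = (\<Sum>x<N. if x = x0 then of_real a else 0)"
          by (intro sum.cong refl) (use \<phi>_1 in \<open>simp add: start_def\<close>)
        also have "\<dots> = of_real a" using f(1) by simp
        finally have 1: "(\<Sum>x<N. \<phi> (x, 0, 1) + start (x, 0, 1)) = of_real a" .
        have 2: "\<phi> (0, 0, 0) + start (0, 0, 0) = of_real (1/2)"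
          using \<phi>_product[OF z0] by (simp add: c_def start_def)
        show ?thesis
          unfolding S_def using sum_pub[OF N, where g = "Suc g" and m = m and \<sigma> = \<sigma> and F = "\<lambda>j. \<phi> j + start j"]
          unfolding 1 2 by simp
      qed
      ultimately have "(\<Sum>j\<in>S. of_real (pub N \<sigma> j) * (\<phi> j + start j)) = 0" by simp
      then have "apply_op S R (\<lambda>i. \<phi> i + start i) i = of_real (parity_sign i) * (\<phi> i + start i)"
        using i by (simp add: apply_reflection S_def R_def)
      moreover have "parity_sign i = - 1 \<or> \<phi> i + start i = 0"
      proof (cases "even l")
        case True
        then show ?thesis
          using \<phi>_product[of x r l] i by (auto simp: xrl parity_sign_def start_def)
      next
        case False
        show ?thesis
        proof (cases "r = 0 \<and> l \<noteq> 1")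
          case True
          then have "l \<ge> 3" using False by presburger
          then obtain n where n: "l = Suc (Suc n)" "odd n"
            using False by (auto dest: le_Suc_ex simp: numeral_3_eq_3)
          have "v * d False l + u * d True l
             = (- 1) ^ Suc n * (u * (- \<rho>) ^ (Suc n div 2) + v * (- \<rho>) ^ (n div 2))"
            by (simp add: d_def n algebra_simps del: div_Suc)
          also have "\<dots> = 0"
            using neg_power_half_cancel[OF \<rho>(1) n(2)] by simp
          finally have "v * d False l + u * d True l = 0" .
          moreover have "weight False x * c False x l + weight True x * c True x l
             = (if x = x0 then a / u * (v * d False l + u * d True l) else 0)"
            by (simp add: c_def n u_def v_def algebra_simps)
          ultimately show ?thesis
            using \<phi>_0[of x l] i True n by (auto simp: xrl start_def)
        next
          case False
          with \<open>odd l\<close> show ?thesis by (auto simp: xrl parity_sign_def)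
        qed
      qed
      ultimately show ?thesis
        by (metis (no_types, lifting) minus_zero mult_minus1 mult_zero_right of_real_1 of_real_minus)
    next
      case False
      then show ?thesis using A_outside z0 by (auto simp: apply_op_def \<phi>_def start_def)
    qed
  qed
  have "W g \<phi> = apply_op S R (A (rescaled (\<lambda>b x l. c b x (hop H b l))))"
    unfolding \<phi>_def A_def S_def R_def H_def \<sigma>_def by (rule walk_rescaled)
  also have "\<dots> = (\<lambda>i. apply_op S R \<eta> i + (\<phi> i + start i))"
    unfolding hop_image isometry_diff[OF R_iso] reflected by (simp add: algebra_simps)
  finally have cob: "start = (\<lambda>i. W g \<phi> i - \<phi> i + (- 1) * apply_op S R \<eta> i)"
    by (simp add: fun_eq_iff)
  have K0: "K > 0"
  proof -
    have "0 < 6 * sqrt N / \<epsilon>" using N \<epsilon> by simp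
    then show ?thesis using K by linarith
  qed
  have "nrm S (cesaro (W g) K start) \<le> 2 * nrm S \<phi> / K + nrm S (\<lambda>i. (- 1) * apply_op S R \<eta> i)"
    unfolding S_def
    by (rule cesaro_coboundary_upper_bound[where W = "W g", OF isometry_W[OF \<epsilon>] K0 cob[unfolded S_def]])
  also have "nrm S (\<lambda>i. (- 1) * apply_op S R \<eta> i) = nrm S (rescaled e)"
    unfolding nrm_scale isometry_nrm[OF R_iso] \<eta>_def isometry_nrm[OF A_iso] by simp
  also have "nrm S \<phi> = nrm S (rescaled c)"
    unfolding \<phi>_def isometry_nrm[OF A_iso] ..
  finally have main: "nrm S (cesaro (W g) K start) \<le> 2 * nrm S (rescaled c) / K + nrm S (rescaled e)" .
  \<comment> \<open>Here \<open>4 * \<sigma> = \<epsilon>\<close>.\<close>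
  have a2: "a\<^sup>2 \<le> N / \<epsilon>"
  proof -
    have "a\<^sup>2 = (1 - \<sigma>) / (4 * (\<sigma> / N))"
      using \<sigma> by (simp add: a_def power_divide power_mult_distrib)
    also have "\<dots> = (1 - \<sigma>) * (N / \<epsilon>)" by (simp add: \<sigma>_def)
    also have "\<dots> \<le> 1 * (N / \<epsilon>)" using \<sigma> \<epsilon> by (intro mult_right_mono) auto
    finally show ?thesis by simp
  qed
  have sign_sq: "((- 1 :: real) ^ n)\<^sup>2 = 1" for n
    by (cases "even n") auto
  \<comment> \<open>The far end is \<open>Suc k\<close>, where the amplitude carries the exponent
    \<open>k div 2\<close>; this is the exponent in the assumption on \<open>g\<close>.\<close>
  obtain k where k: "H = Suc (Suc k)" "k div 2 = 2^g - 1"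
  proof
    have "(1::nat) \<le> 2^g" by simp
    then show "H = Suc (Suc (2 * (2^g - 1)))" unfolding H_def power_Suc by arith
  qed simp
  have "(nrm S (rescaled c))\<^sup>2 = (\<Sum>x<N. \<Sum>l<H. weight False x * (c False x l)\<^sup>2 + weight True x * (c True x l)\<^sup>2)"
    unfolding S_def H_def by (rule nrm_rescaled)
  also have "\<dots> \<le> (\<Sum>x<N. (if x = 0 then 1/4 else 0) + (if x = x0 then 2 * a\<^sup>2 / \<epsilon> else 0))"
  proof (rule sum_mono)
    fix x assume "x \<in> {..<N}"
    then have x: "weight False x + weight True x = 1" using weight_total by simp
    have "(\<Sum>l<H. weight False x * (c False x l)\<^sup>2 + weight True x * (c True x l)\<^sup>2)
      = (weight False x + weight True x) * (c True x 0)\<^sup>2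
        + (\<Sum>l<Suc k. weight False x * (c False x (Suc l))\<^sup>2 + weight True x * (c True x (Suc l))\<^sup>2)"
      unfolding k sum.lessThan_Suc_shift[of _ "Suc k"] by (simp add: c_def algebra_simps)
    also have "(weight False x + weight True x) * (c True x 0)\<^sup>2 = (if x = 0 then 1/4 else 0)"
      using x by (simp add: c_def power2_eq_square)
    also have "(\<Sum>l<Suc k. weight False x * (c False x (Suc l))\<^sup>2 + weight True x * (c True x (Suc l))\<^sup>2)
       \<le> (if x = x0 then 2 * a\<^sup>2 / \<epsilon> else 0)"
    proof (cases "x = x0")
      case True
      have "(\<Sum>l<Suc k. weight False x * (c False x (Suc l))\<^sup>2 + weight True x * (c True x (Suc l))\<^sup>2)
         = (\<Sum>l<Suc k. (a / u)\<^sup>2 * (v * (d False (Suc l))\<^sup>2 + u * (d True (Suc l))\<^sup>2))"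
        by (simp only: True c_def u_def[symmetric] v_def[symmetric])
           (simp add: power_mult_distrib power_divide algebra_simps)
      also have "\<dots> = (a / u)\<^sup>2 * (\<Sum>l<Suc k. v * (d False (Suc l))\<^sup>2 + u * (d True (Suc l))\<^sup>2)"
        by (rule sum_distrib_left[symmetric])
      \<comment> \<open>At \<open>l = 1\<close> only answer 1 contributes, giving \<open>u\<close>;
        the geometric series starts at \<open>l = 2\<close>.\<close>
      also have "(\<Sum>l<Suc k. v * (d False (Suc l))\<^sup>2 + u * (d True (Suc l))\<^sup>2)
          = u + (\<Sum>l<k. u * ((- \<rho>) ^ (Suc l div 2))\<^sup>2 + v * ((- \<rho>) ^ (l div 2))\<^sup>2)"
        unfolding sum.lessThan_Suc_shift by (simp add: d_def power_mult_distrib sign_sq add.commute del: div_Suc)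
      also have "\<dots> = u + (\<Sum>l<k. \<rho> ^ l)"
        by (simp add: neg_power_half_weight[OF \<rho>(1) w(2)] del: div_Suc)
      also have "(a / u)\<^sup>2 * \<dots> \<le> (a / u)\<^sup>2 * (u + u / (2 * \<epsilon>))"
      proof -
        have "(\<Sum>l<k. \<rho> ^ l) \<le> 1 / (1 - \<rho>)"
          using \<rho> \<epsilon> by (intro geometric_sum_le) auto
        also have "1 - \<rho> = (u - v) / u" using u by (simp add: \<rho>_def field_simps)
        also have "1 / ((u - v) / u) \<le> u / (2 * \<epsilon>)"
          using u w \<epsilon> by (simp, intro divide_left_mono) auto
        finally show ?thesis by (intro mult_left_mono add_left_mono) auto
      qed
      also have "\<dots> = a\<^sup>2 * ((1 + 1 / (2 * \<epsilon>)) / u)"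
        using u by (simp add: power_divide power2_eq_square field_simps)
      \<comment> \<open>Uses \<open>u \<ge> 1/2\<close>, and
        \<open>1 \<le> 1 / (2 * \<epsilon>)\<close>, which is the bound
        \<open>\<epsilon> \<le> 1/2\<close>.\<close>
      also have "(1 + 1 / (2 * \<epsilon>)) / u \<le> (1 / (2 * \<epsilon>) + 1 / (2 * \<epsilon>)) / (1/2)"
        using u \<epsilon> by (intro frac_le add_right_mono) (auto simp: field_simps)
      also have "a\<^sup>2 * \<dots> = 2 * a\<^sup>2 / \<epsilon>" by simp
      finally show ?thesis using True by (simp add: mult_left_mono)
    qed (simp add: c_def)
    finally show "(\<Sum>l<H. weight False x * (c False x l)\<^sup>2 + weight True x * (c True x l)\<^sup>2)
       \<le> (if x = 0 then 1/4 else 0) + (if x = x0 then 2 * a\<^sup>2 / \<epsilon> else 0)" by simp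
  qed
  also have "\<dots> = 1/4 + 2 * a\<^sup>2 / \<epsilon>"
    using N f(1) by (simp add: sum.distrib)
  \<comment> \<open>The coefficients 1/4 and 2 add up to 9/4, the square of 3/2.\<close>
  also have "\<dots> \<le> N / (4 * \<epsilon>\<^sup>2) + 2 * (N / \<epsilon>) / \<epsilon>"
  proof (intro add_mono divide_right_mono mult_left_mono a2)
    have "\<epsilon>\<^sup>2 \<le> 1\<^sup>2" using \<epsilon> by (intro power_mono) auto
    then have "\<epsilon>\<^sup>2 \<le> N" using N by simp
    then show "1/4 \<le> N / (4 * \<epsilon>\<^sup>2)" using \<epsilon> by (simp add: field_simps)
  qed (use \<epsilon> in auto)
  also have "\<dots> = (3/2 * (sqrt N / \<epsilon>))\<^sup>2"
    by (simp add: power_mult_distrib power_divide power2_eq_square)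
  finally have "nrm S (rescaled c) \<le> 3/2 * (sqrt N / \<epsilon>)"
    by (rule power2_le_imp_le) (use \<epsilon> in auto)
  also have "\<dots> \<le> real K / 4" using K by simp
  finally have c: "2 * nrm S (rescaled c) / K \<le> 1/2" using K0 by (simp add: field_simps)
  have "(nrm S (rescaled e))\<^sup>2 = (\<Sum>x<N. \<Sum>l<H. weight False x * (e False x l)\<^sup>2 + weight True x * (e True x l)\<^sup>2)"
    unfolding S_def H_def by (rule nrm_rescaled)
  also have "\<dots> = (\<Sum>x<N. \<Sum>l<H. if l = Suc k then weight True x * (2 * c True x l)\<^sup>2 else 0)"
    by (intro sum.cong refl) (simp add: e_def k)
  also have "\<dots> = (\<Sum>x<N. if x = x0 then u * (2 * (a / u * d True (Suc k)))\<^sup>2 else 0)"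
    by (intro sum.cong refl) (simp add: k c_def u_def power_mult_distrib power_divide)
  also have "\<dots> = u * (2 * (a / u * d True (Suc k)))\<^sup>2"
    using f(1) by simp
  also have "\<dots> = 4 / u * a\<^sup>2 * (\<rho> ^ (2^g - 1))\<^sup>2"
  proof -
    have "(d True (Suc k))\<^sup>2 = (\<rho> ^ (2^g - 1))\<^sup>2"
      by (simp add: d_def k power_mult_distrib sign_sq) (simp flip: power_mult add: mult.commute[of _ 2])
    then show ?thesis
      using u by (simp add: power_mult_distrib power_divide power2_eq_square field_simps)
  qed
  also have "\<dots> \<le> 8 * (N / \<epsilon>) * ((1 - 2 * \<epsilon>) ^ (2^g - 1))\<^sup>2"
    using u \<rho> a2 \<epsilon> by (intro mult_mono power_mono) (auto simp: field_simps)
  also have "\<dots> \<le> (1/20)\<^sup>2" using g by (simp add: power2_eq_square)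
  finally have "nrm S (rescaled e) \<le> 1/20"
    by (rule power2_le_imp_le) simp
  \<comment> \<open>The sum of 1/2 and 1/20; its square 121/400 is below 1/3.\<close>
  with c main have "nrm S (cesaro (W g) K start) \<le> 11/20" by linarith
  then have "(nrm S (cesaro (W g) K start))\<^sup>2 \<le> (11/20)\<^sup>2"
    by (intro power_mono) auto
  also have "\<dots> \<le> 1/3" by (simp add: power2_eq_square)
  finally show ?thesis unfolding S_def .
qed

end

section \<open>Choice of the counter size and of the line length\<close>

lemma power_of_two_between:
  assumes "(X::real) \<ge> 1"
  obtains s :: nat where "X \<le> 2 ^ s" "2 ^ s \<le> 2 * X"
proof -
  obtain n where "X < 2 ^ n" using real_arch_pow[of 2 X] by auto
  then have ex: "\<exists>n. X \<le> 2 ^ n" by (auto intro: less_imp_le)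
  define s where "s = (LEAST n. X \<le> 2 ^ n)"
  have "X \<le> 2 ^ s" unfolding s_def by (rule LeastI_ex[OF ex])
  moreover have "2 ^ s \<le> 2 * X"
  proof (cases s)
    case (Suc r)
    then have "\<not> X \<le> 2 ^ r" using not_less_Least[of r "\<lambda>n. X \<le> 2 ^ n"] by (simp add: s_def)
    then show ?thesis by (simp add: Suc)
  qed (use assms in simp)
  ultimately show ?thesis by (rule that)
qed

text \<open>The line length affects the ancilla count but not the number of queries, so
  \<open>g\<close> may be as large as the accuracy demands.\<close>

lemma small_power_exponent:
  assumes "0 \<le> (t::real)" "t < 1" "C > 0" "\<delta> > 0"
  obtains g :: nat where "C * (t ^ (2^g - 1))\<^sup>2 \<le> \<delta>"
proof -
  obtain n where n: "t ^ n < \<delta> / C"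
    using real_arch_pow_inv[of "\<delta> / C" t] assms by auto
  have "n \<le> 2^n - 1" using less_exp[of n] by linarith
  then have "t ^ (2^n - 1) \<le> t ^ n" using assms by (intro power_decreasing) auto
  moreover have "(t ^ (2^n - 1))\<^sup>2 \<le> t ^ (2^n - 1)"
    using assms by (simp add: power2_eq_square mult_left_le power_le_one)
  ultimately have "(t ^ (2^n - 1))\<^sup>2 \<le> \<delta> / C" using n by linarith
  then have "C * (t ^ (2^n - 1))\<^sup>2 \<le> \<delta>"
    using \<open>C > 0\<close> by (simp add: field_simps)
  then show ?thesis by (rule that)
qed

theorem theorem3:
  shows "\<exists>c C :: real. 0 < c \<and> 0 < C \<and>
    (\<forall>(N::nat) (m::nat) (\<epsilon>::real). N \<ge> 1 \<longrightarrow> m \<ge> 1 \<longrightarrow> 0 < \<epsilon> \<longrightarrow> \<epsilon> \<le> 1/2 \<longrightarrow>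
      (\<exists>(q::nat) (T::nat) Us useinv out.
         c * sqrt (real N) / \<epsilon> \<le> real T \<and> real T \<le> C * sqrt (real N) / \<epsilon> \<and>
         (\<forall>k\<le>T. is_unitary_on (basis N m q) (Us k)) \<and>
         (\<forall>f Orc. biased_oracle N m f \<epsilon> Orc \<longrightarrow>
            prob_output (basis N m q) (run (basis N m q) Us useinv (lift_oracle Orc) T) out
              (\<exists>x<N. f x) \<ge> 2/3)))"
proof (rule exI[of _ 12], rule exI[of _ 24], intro conjI allI impI)
  fix N m :: nat and \<epsilon> :: real
  assume N: "N \<ge> 1" and m: "m \<ge> 1" and \<epsilon>: "0 < \<epsilon>" "\<epsilon> \<le> 1/2"
  have "1 * 1 \<le> 6 * sqrt N * (1 / \<epsilon>)"
    using N \<epsilon> by (intro mult_mono) (auto simp: field_simps intro: order_trans[of 1 "sqrt N"])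
  \<comment> \<open>The counter is a qubit register, so its size is a power of two; rounding up
    costs at most a factor 2. Two queries per counter value then give the constants 12 and
    24.\<close>
  then obtain s :: nat where s: "6 * sqrt N / \<epsilon> \<le> 2 ^ s" "2 ^ s \<le> 2 * (6 * sqrt N / \<epsilon>)"
    using power_of_two_between[of "6 * sqrt N / \<epsilon>"] by auto
  obtain g :: nat where g: "8 * (N / \<epsilon>) * ((1 - 2 * \<epsilon>) ^ (2^g - 1))\<^sup>2 \<le> 1/400"
    using small_power_exponent[of "1 - 2 * \<epsilon>" "8 * (N / \<epsilon>)" "1/400"] N \<epsilon> by auto
  \<comment> \<open>Circuit and output rule depend on \<open>N\<close> and \<open>\<epsilon>\<close>
    only, hence are fixed before \<open>f\<close> and the oracle are given. The answer is true when
    the counter is found nonzero.\<close>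
  define B where "B = involution (shift (2 ^ Suc g))"
  define D where "D = reflection (pub N (\<epsilon> / 4)) parity_sign"
  define q where "q = s + Suc g"
  define Us where "Us = steps (2 ^ Suc g) (2 ^ s) B D"
  define out :: "idx \<Rightarrow> bool" where "out = (\<lambda>i. layer (2 ^ Suc g) i \<noteq> 0)"
  have B: "is_unitary_on (basis N m (Suc g)) B"
    unfolding B_def by (rule unitary_shift)
  have D: "is_unitary_on (basis N m (Suc g)) D"
    unfolding D_def by (rule unitary_public_reflection) (use N \<epsilon> in auto)
  have correct: "prob_output (basis N m q) (run (basis N m q) Us odd (lift_oracle Orc) (2 * 2 ^ s)) out
      (\<exists>x<N. f x) \<ge> 2/3" if bo: "biased_oracle N m f \<epsilon> Orc" for f Orc
  proof -
    interpret biased N m f \<epsilon> Orc by (rule biased.intro[OF bo N])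
    note prob = prob_output_interference[OF unitary_Orc N B D, of s, folded q_def Us_def out_def]
    show ?thesis
    proof (cases "\<exists>x<N. f x")
      case True
      then obtain x0 where "x0 < N" "f x0" by blast
      then have "(nrm (basis N m (Suc g)) (cesaro (walk (basis N m (Suc g)) B D Q) (2^s) start))\<^sup>2 \<le> 1/3"
        unfolding B_def D_def by (rule cesaro_upper_bound) (use \<epsilon> s g in auto)
      moreover have "(\<exists>x<N. f x) = True" using True by blast
      ultimately show ?thesis using prob(2) by (simp only:)
    next
      case False
      then have "2/3 \<le> (nrm (basis N m (Suc g)) (cesaro (walk (basis N m (Suc g)) B D Q) (2^s) start))\<^sup>2"
        unfolding B_def D_def by (intro cesaro_lower_bound) (use \<epsilon> in auto)
      moreover have "(\<exists>x<N. f x) = False" using False by blast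
      ultimately show ?thesis using prob(1) by (simp only:)
    qed
  qed
  show "\<exists>q T Us useinv out. 12 * sqrt (real N) / \<epsilon> \<le> real T \<and> real T \<le> 24 * sqrt (real N) / \<epsilon> \<and>
      (\<forall>k\<le>T. is_unitary_on (basis N m q) (Us k)) \<and>
      (\<forall>f Orc. biased_oracle N m f \<epsilon> Orc \<longrightarrow>
        prob_output (basis N m q) (run (basis N m q) Us useinv (lift_oracle Orc) T) out
          (\<exists>x<N. f x) \<ge> 2/3)"
  proof (intro exI conjI allI impI)
    show "12 * sqrt (real N) / \<epsilon> \<le> real (2 * 2 ^ s)" "real (2 * 2 ^ s) \<le> 24 * sqrt (real N) / \<epsilon>"
      using s by simp_all
    show "is_unitary_on (basis N m q) (Us k)" for k
      unfolding q_def Us_def by (rule unitary_steps[OF B D])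
  qed (rule correct)
qed simp_all

end
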